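(* Let $f,\mathcal X,\mathcal Y,\ell,D_{\mathcal Y}$ be as in the context and let $\{(x^t,y^t,z^t)\}_{t\ge0}$ be generated by Perturbed Smoothed GDA with parameters satisfying the step-size conditions for Perturbed Smoothed GDA listed in the context. For $T\in\{1,2,\dots\}\cup\{\infty\}$ define $$\mathcal I^\star(T)=\bigcup_{t=1}^{T}\ \arg\min_{k\in\{\lfloor t/2\rfloor,\dots,t\}}\Big\{\frac{1}{8c^k}\|x^{k+1}-x^k\|^2+\frac{1}{16\alpha^k}\|y^k-y^k_+(z^k)\|^2+\frac{r_x\beta^k}{8}\|z^k-x^{k+1}\|^2\Big\},$$ where $y_+^k(z)=\mathrm{proj}_{\mathcal Y}\big(y^k+\alpha^k\nabla_yF_k(x_k(y^k,z),y^k,z)\big)$ and $x_k(y,z)=\arg\min_{x\in\mathcal X}F_k(x,y,z)$. If $r_y^t\searrow0$ (i.e. $\{r_y^t\}$ is non-increasing and converges to $0$) and $t\cdot r_y^t\to\infty$ as $t\to\infty$, then any limit point of $\{(x^t,y^t)\}_{t\in\mathcal I^\star(\infty)}$ is a $0$-GS of $\min_{x\in\mathcal X}\max_{y\in\mathcal Y}f(x,y)$.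
   Context: Setting: $f:\mathbb R^n\times\mathbb R^d\to\mathbb R$; $\mathcal X\subseteq\mathbb R^n$ is nonempty, closed and convex; $\mathcal Y\subseteq\mathbb R^d$ is nonempty, compact and convex with $0\in\mathcal Y$ and diameter $D_{\mathcal Y}>0$. The function $f$ is continuously differentiable and $\ell$-smooth ($\ell>0$): for all $x,x'\in\mathcal X$, $y,y'\in\mathcal Y$, both $\|\nabla_xf(x,y)-\nabla_xf(x',y')\|$ and $\|\nabla_yf(x,y)-\nabla_yf(x',y')\|$ are at most $\ell(\|x-x'\|+\|y-y'\|)$. For each $x\in\mathcal X$, $f(x,\cdot)$ is concave. Stationarity: $\iota_S$ is the indicator function of a set $S$ ($0$ on $S$, $+\infty$ outside), and $\partial\iota_S$ its subdifferential. For $\epsilon\ge0$, a pair $(x,y)\in\mathcal X\times\mathcal Y$ is an $\epsilon$-game-stationary point ($\epsilon$-GS) if $\mathrm{dist}(0,\nabla_xf(x,y)+\partial\iota_{\mathcal X}(x))\le\epsilon$ and $\mathrm{dist}(0,-\nabla_yf(x,y)+\partial\iota_{\mathcal Y}(y))\le\epsilon$. Perturbed Smoothed GDA: let $F_t(x,y,z)=f(x,y)+\frac{r_x}{2}\|x-z\|^2-\frac{r_y^t}{2}\|y\|^2$. From $(x^0,y^0,z^0)$, iterate for $t=0,1,\dots$ $$x^{t+1}=\mathrm{proj}_{\mathcal X}(x^t-c^t\nabla_xF_t(x^t,y^t,z^t)),\quad y^{t+1}=\mathrm{proj}_{\mathcal Y}(y^t+\alpha^t\nabla_yF_t(x^{t+1},y^t,z^t)),\quad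 z^{t+1}=z^t+\beta^t(x^{t+1}-z^t).$$ Step-size conditions for Perturbed Smoothed GDA: $r_x=\Theta(\ell)$ with $r_x>3\ell$, $r_y^t>0$, and for all $t\ge0$: $\alpha^t=\Theta(1/\ell)$ and $0<\alpha^t\le\min\Big\{\frac{1}{11(\ell+r_y^t)},\frac{(c^t)^2(r_x-\ell-r_y^t)^2}{4(\ell+r_y^t)(1+c^t(r_x-\ell-r_y^t))^2}\Big\}$; $c^t=\Theta(1/\ell)$ and $0<c^t<\frac{1}{r_x+\ell+r_y^t}$; $0<\beta^t\le\min\Big\{\frac1{36},\frac{(r_x-\ell-r_y^t)^2}{384r_x(r_x+\ell+r_y^t)^2}\Big\}$; $\beta^t=\Theta(r_y^t/\ell)$ and $0<\beta^t\le\frac{1}{384r_x\alpha^t(\omega^t)^2}$, where $\omega^t=\frac{1}{\sqrt{r_y^t}}\cdot\frac{(r_x-\ell-r_y^t)+\alpha^t(\ell+r_y^t)(3r_x-2\ell-2r_y^t)}{\alpha^t(r_x-\ell-r_y^t)^{3/2}}$. It is assumed that $\min_{x\in\mathcal X}\max_{y\in\mathcal Y}\{f(x,y)-\frac{r_y^0}{2}\|y\|^2\}$ is finite. $\Theta$ hides positive constants independent of $t$. *)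

theory Defs
  imports "HOL-Analysis.Analysis"
begin

section \<open>Gradients and smoothness\<close>

definition grad :: "('a::real_inner \<Rightarrow> real) \<Rightarrow> 'a \<Rightarrow> 'a" where
  "grad g p = (THE D. GDERIV g p :> D)"

lemma grad_eqI:
  fixes g :: "'a::real_inner \<Rightarrow> real"
  assumes "GDERIV g p :> D"
  shows "grad g p = D"
  unfolding grad_def
proof (rule the_equality)
  fix E assume "GDERIV g p :> E"
  with assms have "(\<lambda>h. inner h E) = (\<lambda>h. inner h D)"
    unfolding gderiv_def by (rule has_derivative_unique[rotated])
  then have "inner (E - D) (E - D) = 0"
    by (simp add: inner_diff_right fun_eq_iff)
  then show "E = D" by simp
qed (fact assms)

definition cont_diff :: "('a::euclidean_space \<Rightarrow> real) \<Rightarrow> bool" where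
  "cont_diff g \<longleftrightarrow> (\<forall>p. g differentiable (at p)) \<and> continuous_on UNIV (grad g)"

definition smooth_on ::
  "real \<Rightarrow> 'a::euclidean_space set \<Rightarrow> 'b::euclidean_space set \<Rightarrow> ('a \<Rightarrow> 'b \<Rightarrow> real) \<Rightarrow> bool" where
  "smooth_on L X Y f \<longleftrightarrow>
     (\<forall>x\<in>X. \<forall>x'\<in>X. \<forall>y\<in>Y. \<forall>y'\<in>Y.
        norm (grad (\<lambda>u. f u y) x - grad (\<lambda>u. f u y') x') \<le> L * (norm (x - x') + norm (y - y')) \<and>
        norm (grad (\<lambda>v. f x v) y - grad (\<lambda>v. f x' v) y') \<le> L * (norm (x - x') + norm (y - y')))"

section \<open>Game stationarity\<close>

definition ind_fun :: "'a set \<Rightarrow> 'a \<Rightarrow> ereal" where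
  "ind_fun S x = (if x \<in> S then 0 else \<infinity>)"

definition subdifferential :: "('a::real_inner \<Rightarrow> ereal) \<Rightarrow> 'a \<Rightarrow> 'a set" where
  "subdifferential h x = {v. \<forall>u. h u \<ge> h x + ereal (inner v (u - x))}"

text \<open>\<^const>\<open>infdist\<close> is \<open>0\<close> on the empty set, but the two sets below are nonempty:
  \<open>0\<close> is a subgradient of the indicator function at every point of the set.\<close>

definition game_stationary ::
  "('a::euclidean_space \<Rightarrow> 'b::euclidean_space \<Rightarrow> real) \<Rightarrow> 'a set \<Rightarrow> 'b set \<Rightarrow> real \<Rightarrow> 'a \<times> 'b \<Rightarrow> bool" where
  "game_stationary f X Y \<epsilon> = (\<lambda>(x, y). x \<in> X \<and> y \<in> Y \<and>
     infdist 0 ((\<lambda>v. grad (\<lambda>u. f u y) x + v) ` subdifferential (ind_fun X) x) \<le> \<epsilon> \<and>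
     infdist 0 ((\<lambda>v. - grad (\<lambda>u. f x u) y + v) ` subdifferential (ind_fun Y) y) \<le> \<epsilon>)"

section \<open>Perturbed Smoothed GDA\<close>

text \<open>Superscripts \<open>t\<close> become arguments of sequences: \<open>ry t\<close>, \<open>c t\<close>, \<open>\<alpha> t\<close>, \<open>\<beta> t\<close>.
  The function \<open>F\<^sub>t\<close> is \<open>Freg f rx (ry t)\<close>.\<close>

definition Freg ::
  "('a::euclidean_space \<Rightarrow> 'b::euclidean_space \<Rightarrow> real) \<Rightarrow> real \<Rightarrow> real \<Rightarrow> 'a \<Rightarrow> 'b \<Rightarrow> 'a \<Rightarrow> real" where
  "Freg f rx r x y z = f x y + rx / 2 * (norm (x - z))\<^sup>2 - r / 2 * (norm y)\<^sup>2"

definition psgda ::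
  "('a::euclidean_space \<Rightarrow> 'b::euclidean_space \<Rightarrow> real) \<Rightarrow> 'a set \<Rightarrow> 'b set \<Rightarrow> real \<Rightarrow>
   (nat \<Rightarrow> real) \<Rightarrow> (nat \<Rightarrow> real) \<Rightarrow> (nat \<Rightarrow> real) \<Rightarrow> (nat \<Rightarrow> real) \<Rightarrow>
   (nat \<Rightarrow> 'a) \<Rightarrow> (nat \<Rightarrow> 'b) \<Rightarrow> (nat \<Rightarrow> 'a) \<Rightarrow> bool" where
  "psgda f X Y rx ry c \<alpha> \<beta> x y z \<longleftrightarrow> (\<forall>t.
     x (Suc t) = closest_point X (x t - c t *\<^sub>R grad (\<lambda>u. Freg f rx (ry t) u (y t) (z t)) (x t)) \<and>
     y (Suc t) = closest_point Y (y t + \<alpha> t *\<^sub>R grad (\<lambda>v. Freg f rx (ry t) (x (Suc t)) v (z t)) (y t)) \<and>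
     z (Suc t) = z t + \<beta> t *\<^sub>R (x (Suc t) - z t))"

text \<open>\<open>u t = \<Theta>(v t)\<close> with constants independent of \<open>t\<close>, for all \<open>t\<close> and not only eventually.\<close>

definition theta_all :: "(nat \<Rightarrow> real) \<Rightarrow> (nat \<Rightarrow> real) \<Rightarrow> bool" where
  "theta_all u v \<longleftrightarrow> (\<exists>a>0. \<exists>b>0. \<forall>t. a * v t \<le> u t \<and> u t \<le> b * v t)"

definition omega :: "real \<Rightarrow> real \<Rightarrow> real \<Rightarrow> real \<Rightarrow> real" where
  "omega L rx r a =
     1 / sqrt r * (((rx - L - r) + a * (L + r) * (3 * rx - 2 * L - 2 * r)) / (a * (rx - L - r) powr (3/2)))"

text \<open>The formula for \<open>\<omega>\<^sup>t\<close> presupposes \<open>rx - L - ry t > 0\<close>. This is not a separate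
  condition here: for \<open>rx > 3 * L\<close> and \<open>ry\<close> tending to \<open>0\<close> it holds for all large \<open>t\<close>.\<close>

definition psgda_steps ::
  "real \<Rightarrow> real \<Rightarrow> (nat \<Rightarrow> real) \<Rightarrow> (nat \<Rightarrow> real) \<Rightarrow> (nat \<Rightarrow> real) \<Rightarrow> (nat \<Rightarrow> real) \<Rightarrow> bool" where
  "psgda_steps L rx ry c \<alpha> \<beta> \<longleftrightarrow>
     theta_all (\<lambda>t. rx) (\<lambda>t. L) \<and> rx > 3 * L \<and>
     (\<forall>t. ry t > 0) \<and>
     theta_all \<alpha> (\<lambda>t. 1 / L) \<and>
     (\<forall>t. 0 < \<alpha> t \<and>
        \<alpha> t \<le> min (1 / (11 * (L + ry t)))
                  ((c t)\<^sup>2 * (rx - L - ry t)\<^sup>2 /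
                    (4 * (L + ry t) * (1 + c t * (rx - L - ry t))\<^sup>2))) \<and>
     theta_all c (\<lambda>t. 1 / L) \<and>
     (\<forall>t. 0 < c t \<and> c t < 1 / (rx + L + ry t)) \<and>
     (\<forall>t. 0 < \<beta> t \<and>
        \<beta> t \<le> min (1 / 36) ((rx - L - ry t)\<^sup>2 / (384 * rx * (rx + L + ry t)\<^sup>2))) \<and>
     theta_all \<beta> (\<lambda>t. ry t / L) \<and>
     (\<forall>t. 0 < \<beta> t \<and> \<beta> t \<le> 1 / (384 * rx * \<alpha> t * (omega L rx (ry t) (\<alpha> t))\<^sup>2))"

section \<open>The index set\<close>

definition xmin ::
  "('a::euclidean_space \<Rightarrow> 'b::euclidean_space \<Rightarrow> real) \<Rightarrow> 'a set \<Rightarrow> real \<Rightarrow> real \<Rightarrow> 'b \<Rightarrow> 'a \<Rightarrow> 'a" where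
  "xmin f X rx r y z = arg_min (\<lambda>x. Freg f rx r x y z) (\<lambda>x. x \<in> X)"

text \<open>\<open>y\<^sub>+\<^sup>k(z)\<close> for \<open>y = y\<^sup>k\<close>, \<open>r = r\<^sub>y\<^sup>k\<close>, \<open>a = \<alpha>\<^sup>k\<close>.\<close>

definition yplus ::
  "('a::euclidean_space \<Rightarrow> 'b::euclidean_space \<Rightarrow> real) \<Rightarrow> 'a set \<Rightarrow> 'b set \<Rightarrow> real \<Rightarrow> real \<Rightarrow> real \<Rightarrow>
   'b \<Rightarrow> 'a \<Rightarrow> 'b" where
  "yplus f X Y rx r a y z =
     closest_point Y (y + a *\<^sub>R grad (\<lambda>v. Freg f rx r (xmin f X rx r y z) v z) y)"

definition residual ::
  "('a::euclidean_space \<Rightarrow> 'b::euclidean_space \<Rightarrow> real) \<Rightarrow> 'a set \<Rightarrow> 'b set \<Rightarrow> real \<Rightarrow>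
   (nat \<Rightarrow> real) \<Rightarrow> (nat \<Rightarrow> real) \<Rightarrow> (nat \<Rightarrow> real) \<Rightarrow> (nat \<Rightarrow> real) \<Rightarrow>
   (nat \<Rightarrow> 'a) \<Rightarrow> (nat \<Rightarrow> 'b) \<Rightarrow> (nat \<Rightarrow> 'a) \<Rightarrow> nat \<Rightarrow> real" where
  "residual f X Y rx ry c \<alpha> \<beta> x y z k =
     1 / (8 * c k) * (norm (x (Suc k) - x k))\<^sup>2 +
     1 / (16 * \<alpha> k) * (norm (y k - yplus f X Y rx (ry k) (\<alpha> k) (y k) (z k)))\<^sup>2 +
     rx * \<beta> k / 8 * (norm (z k - x (Suc k)))\<^sup>2"

definition Istar ::
  "('a::euclidean_space \<Rightarrow> 'b::euclidean_space \<Rightarrow> real) \<Rightarrow> 'a set \<Rightarrow> 'b set \<Rightarrow> real \<Rightarrow>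
   (nat \<Rightarrow> real) \<Rightarrow> (nat \<Rightarrow> real) \<Rightarrow> (nat \<Rightarrow> real) \<Rightarrow> (nat \<Rightarrow> real) \<Rightarrow>
   (nat \<Rightarrow> 'a) \<Rightarrow> (nat \<Rightarrow> 'b) \<Rightarrow> (nat \<Rightarrow> 'a) \<Rightarrow> enat \<Rightarrow> nat set" where
  "Istar f X Y rx ry c \<alpha> \<beta> x y z T =
     (\<Union>t\<in>{t. 1 \<le> t \<and> enat t \<le> T}.
        {k. is_arg_min (residual f X Y rx ry c \<alpha> \<beta> x y z) (\<lambda>k. k \<in> {t div 2..t}) k})"

text \<open>Limit points of a sequence restricted to an index set. This is not \<open>islimpt\<close> of the set of
  values, which would miss a value that is taken infinitely often.\<close>

definition limit_point_along :: "nat set \<Rightarrow> (nat \<Rightarrow> 'a::topological_space) \<Rightarrow> 'a \<Rightarrow> bool" where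
  "limit_point_along I s p \<longleftrightarrow>
     (\<exists>\<sigma>. strict_mono \<sigma> \<and> (\<forall>j. \<sigma> j \<in> I) \<and> (\<lambda>j. s (\<sigma> j)) \<longlonglongrightarrow> p)"

end

theory Submission
  imports Defs
begin

text \<open>
  For a fixed perturbation \<open>r\<close>, let \<open>d(y,z)\<close> be the minimum of \<open>F(x,y,z)\<close> over \<open>x \<in> X\<close>
  and \<open>q(z)\<close> the maximum of \<open>d(y,z)\<close> over \<open>y \<in> Y\<close>. One step of the algorithm lowers the
  potential \<open>F - 2 d + 2 q\<close> by at least the residual. The only delicate term measures how far the
  minimiser of \<open>F\<close> at \<open>y\<^sub>+\<close> is from the saddle point: strong concavity of modulus \<open>r\<close> in \<open>y\<close> bounds
  it by \<open>\<omega> \<parallel>y - y\<^sub>+\<parallel>\<close> with \<open>\<omega>\<close> of order \<open>1 / sqrt r\<close>, which the bound on \<open>\<beta>\<close> absorbs. Changing \<open>r\<close>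
  costs a multiple of \<open>r\<^sup>t - r\<^sup>t\<^sup>+\<^sup>1\<close>, which telescopes, and the potential is bounded below, so the
  residuals are summable. The smallest residual on the window from \<open>t / 2\<close> to \<open>t\<close> is therefore
  \<open>O(1 / t)\<close>; since \<open>t r\<^sup>t\<close> tends to infinity, even its quotient by \<open>\<beta>\<close> tends to \<open>0\<close> along the index set, and the
  variational inequalities of the projection steps pass to the limit.
\<close>

section \<open>Smooth functions on convex sets\<close>

text \<open>Replaces a limit \<open>s\<close> to 0: if \<open>a > b\<close>, the \<open>s\<close>
  chosen in the proof makes \<open>s * C\<close> at most half of the gap. First-order conditions
  then follow by moving a fraction \<open>s\<close> along a segment.\<close>

lemma le_if_le_add_small:
  fixes a b C :: real
  assumes "\<And>s. 0 < s \<Longrightarrow> s \<le> 1 \<Longrightarrow> a \<le> b + s * C"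
  shows "a \<le> b"
proof (rule ccontr)
  assume "\<not> a \<le> b"
  define s where "s = min 1 ((a - b) / (2 * (\<bar>C\<bar> + 1)))"
  have s: "0 < s" "s \<le> 1" using \<open>\<not> a \<le> b\<close> by (auto simp: s_def)
  have "s * C \<le> s * (\<bar>C\<bar> + 1)" using s by (intro mult_left_mono) auto
  also have "\<dots> \<le> (a - b) / (2 * (\<bar>C\<bar> + 1)) * (\<bar>C\<bar> + 1)"
    by (intro mult_right_mono) (auto simp: s_def)
  also have "\<dots> = (a - b) / 2"
    using abs_ge_zero[of C] by (simp add: divide_simps) linarith
  finally show False using assms[OF s] \<open>\<not> a \<le> b\<close> by simp
qed

text \<open>Riesz representation: the derivative is a linear functional, and its values on
  \<open>Basis\<close> are the coordinates of the gradient.\<close>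

lemma GDERIV_grad:
  fixes g :: "'a::euclidean_space \<Rightarrow> real"
  assumes "g differentiable (at p)"
  shows "GDERIV g p :> grad g p"
proof -
  obtain g' where g': "(g has_derivative g') (at p)"
    using assms unfolding differentiable_def by blast
  then interpret linear g' by (rule has_derivative_linear)
  define D where "D = (\<Sum>b\<in>Basis. g' b *\<^sub>R b)"
  have "g' h = inner h D" for h
  proof -
    have "g' h = g' (\<Sum>b\<in>Basis. inner h b *\<^sub>R b)" by (simp add: euclidean_representation)
    also have "\<dots> = inner h D" by (simp add: sum scaleR D_def inner_sum_right mult.commute)
    finally show ?thesis .
  qed
  then have "GDERIV g p :> D" using g' unfolding gderiv_def by (metis (no_types, lifting) ext)
  then show ?thesis using grad_eqI by metis
qed

text \<open>Along the segment from \<open>u\<close> to \<open>u'\<close>, the difference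
  \<open>h\<close> between \<open>g\<close> and its quadratic model has nonpositive derivative, by
  Cauchy-Schwarz and the Lipschitz bound on the gradient.\<close>

lemma quadratic_upper_bound:
  fixes g :: "'a::euclidean_space \<Rightarrow> real"
  assumes "convex S" "u \<in> S" "u' \<in> S"
    and deriv: "\<And>p. GDERIV g p :> G p"
    and lip: "\<And>p q. p \<in> S \<Longrightarrow> q \<in> S \<Longrightarrow> norm (G p - G q) \<le> L * norm (p - q)"
  shows "g u' \<le> g u + inner (G u) (u' - u) + L / 2 * (norm (u' - u))\<^sup>2"
proof -
  define d where "d = u' - u"
  define h where "h s = g (u + s *\<^sub>R d) - s * inner (G u) d - L / 2 * s\<^sup>2 * (norm d)\<^sup>2" for s :: real
  have "h 1 \<le> h 0"
  proof (rule DERIV_nonpos_imp_nonincreasing[of 0 1 h])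
    fix s :: real assume s: "0 \<le> s" "s \<le> 1"
    define p where "p = u + s *\<^sub>R d"
    have p: "p \<in> S" unfolding p_def d_def
      using convexD_alt[OF assms(1-3) s] by (simp add: algebra_simps)
    have "((\<lambda>s. g (u + s *\<^sub>R d)) has_derivative (\<lambda>k. inner (k *\<^sub>R d) (G p))) (at s)"
      by (rule has_derivative_compose[where g = g and f = "\<lambda>s. u + s *\<^sub>R d"])
        (use deriv[of p] in \<open>auto simp: gderiv_def p_def intro!: derivative_eq_intros\<close>)
    then have 1: "((\<lambda>s. g (u + s *\<^sub>R d)) has_real_derivative inner d (G p)) (at s)"
      by (rule has_derivative_imp_has_field_derivative) (simp add: mult.commute)
    have 2: "(h has_real_derivative inner d (G p) - inner (G u) d - L * s * (norm d)\<^sup>2) (at s)"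
      unfolding h_def by (auto intro!: derivative_eq_intros 1)
    have "inner d (G p) - inner (G u) d = inner (G p - G u) d"
      by (simp add: inner_diff_left inner_diff_right inner_commute)
    also have "\<dots> \<le> norm (G p - G u) * norm d" by (rule norm_cauchy_schwarz)
    also have "\<dots> \<le> L * norm (p - u) * norm d"
      by (intro mult_right_mono lip p assms) auto
    also have "\<dots> = L * s * (norm d)\<^sup>2" using s by (simp add: p_def power2_eq_square)
    finally show "\<exists>y. (h has_real_derivative y) (at s) \<and> y \<le> 0" using 2 by force
  qed simp
  then show ?thesis by (simp add: h_def d_def)
qed

lemma quadratic_lower_bound:
  fixes g :: "'a::euclidean_space \<Rightarrow> real"
  assumes "convex S" "u \<in> S" "u' \<in> S"
    and deriv: "\<And>p. GDERIV g p :> G p"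
    and lip: "\<And>p q. p \<in> S \<Longrightarrow> q \<in> S \<Longrightarrow> norm (G p - G q) \<le> L * norm (p - q)"
  shows "g u' \<ge> g u + inner (G u) (u' - u) - L / 2 * (norm (u' - u))\<^sup>2"
proof -
  have "- g u' \<le> - g u + inner (- G u) (u' - u) + L / 2 * (norm (u' - u))\<^sup>2"
  proof (rule quadratic_upper_bound[where G = "\<lambda>p. - G p" and g = "\<lambda>p. - g p", OF assms(1-3)])
    show "GDERIV (\<lambda>p. - g p) p :> - G p" for p
      using deriv by (rule GDERIV_minus)
    show "norm (- G p - - G q) \<le> L * norm (p - q)" if "p \<in> S" "q \<in> S" for p q
      using lip[OF that] by (simp add: norm_minus_commute)
  qed
  then show ?thesis by simp
qed

text \<open>Move a fraction \<open>s\<close> from \<open>p\<close> towards \<open>u\<close>, divide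
  by \<open>s\<close> and let it shrink. An upper quadratic model of \<open>\<phi>\<close> that
  touches at \<open>p\<close> takes the place of differentiability.\<close>

lemma first_order_optimality:
  fixes \<phi> :: "'a::real_inner \<Rightarrow> real"
  assumes "convex S" "p \<in> S" "u \<in> S"
    and min: "\<And>w. w \<in> S \<Longrightarrow> \<phi> p \<le> \<phi> w"
    and upper: "\<And>w. w \<in> S \<Longrightarrow> \<phi> w \<le> \<phi> p + inner g (w - p) + C * (norm (w - p))\<^sup>2"
  shows "0 \<le> inner g (u - p)"
proof (rule le_if_le_add_small[where C = "C * (norm (u - p))\<^sup>2"])
  fix s :: real assume s: "0 < s" "s \<le> 1"
  define w where "w = p + s *\<^sub>R (u - p)"
  have w: "w \<in> S" unfolding w_def
    using convexD_alt[OF assms(1-3)] s by (simp add: algebra_simps)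
  have "0 \<le> inner g (w - p) + C * (norm (w - p))\<^sup>2"
    using min[OF w] upper[OF w] by linarith
  also have "\<dots> = s * (inner g (u - p) + s * (C * (norm (u - p))\<^sup>2))"
    using s by (simp add: w_def power2_eq_square distrib_left mult_ac)
  finally show "0 \<le> inner g (u - p) + s * (C * (norm (u - p))\<^sup>2)"
    using s by (simp add: zero_le_mult_iff)
qed

text \<open>Concavity bounds the value at the point \<open>w\<close> of the segment from below and
  the quadratic model bounds it from above; the quadratic error is of second order in
  \<open>s\<close>.\<close>

lemma concave_on_le_tangent:
  fixes g :: "'a::real_inner \<Rightarrow> real"
  assumes conc: "concave_on S g" and S: "u \<in> S" "u' \<in> S"
    and upper: "\<And>w. w \<in> S \<Longrightarrow> g w \<le> g u + inner G (w - u) + C * (norm (w - u))\<^sup>2"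
  shows "g u' \<le> g u + inner G (u' - u)"
proof (rule le_if_le_add_small[where C = "C * (norm (u' - u))\<^sup>2"])
  fix s :: real assume s: "0 < s" "s \<le> 1"
  define w where "w = (1 - s) *\<^sub>R u + s *\<^sub>R u'"
  have w: "w \<in> S" unfolding w_def
    using concave_on_imp_convex[OF conc] S s by (intro convexD_alt) auto
  have wu: "w - u = s *\<^sub>R (u' - u)" by (simp add: w_def algebra_simps)
  have "(1 - s) * g u + s * g u' \<le> g w" unfolding w_def
    using concave_onD[OF conc, of s u u'] S s by simp
  also have "\<dots> \<le> g u + inner G (w - u) + C * (norm (w - u))\<^sup>2" by (rule upper[OF w])
  also have "\<dots> = g u + s * (inner G (u' - u) + s * (C * (norm (u' - u))\<^sup>2))"
    unfolding wu using s by (simp add: power2_eq_square distrib_left mult_ac)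
  finally have "s * g u' \<le> s * (g u + (inner G (u' - u) + s * (C * (norm (u' - u))\<^sup>2)))"
    by (simp add: algebra_simps)
  then show "g u' \<le> g u + inner G (u' - u) + s * (C * (norm (u' - u))\<^sup>2)"
    using s by simp
qed

lemma norm_add_sq:
  fixes a b :: "'a::real_inner"
  shows "(norm (a + b))\<^sup>2 = (norm a)\<^sup>2 + 2 * inner a b + (norm b)\<^sup>2"
  by (simp add: power2_norm_eq_inner inner_simps inner_commute)

text \<open>Weighted AM-GM, from the square of \<open>2 * p * a - b\<close>.\<close>

lemma two_mult_le_sq:
  fixes a b :: real
  assumes "4 * q * p \<ge> 1" "p > 0"
  shows "a * b \<le> p * a\<^sup>2 + q * b\<^sup>2"
proof -
  have "1 * b\<^sup>2 \<le> (4 * q * p) * b\<^sup>2" by (rule mult_right_mono) (use assms in auto)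
  moreover have "0 \<le> (2 * p * a - b)\<^sup>2" by simp
  ultimately have "4 * p * (a * b) \<le> 4 * p * (p * a\<^sup>2 + q * b\<^sup>2)"
    by (simp add: power2_eq_square algebra_simps)
  then show ?thesis using assms by simp
qed

section \<open>The regularised saddle-point problem\<close>

text \<open>The perturbation \<open>r\<close> stays a parameter of the lemmas, because the potential
  is later compared at two successive values of it.\<close>

locale reg_minimax =
  fixes f :: "'a::euclidean_space \<Rightarrow> 'b::euclidean_space \<Rightarrow> real"
    and X :: "'a set" and Y :: "'b set" and L rx :: real
  assumes X: "X \<noteq> {}" "closed X" "convex X"
    and Y: "Y \<noteq> {}" "compact Y" "convex Y"
    and diff: "(\<lambda>(u, v). f u v) differentiable (at p)"
    and L_pos: "L > 0" and smooth: "smooth_on L X Y f"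
    and concave: "u \<in> X \<Longrightarrow> concave_on Y (f u)"
    and rx: "rx > 3 * L"
begin

section \<open>Partial gradients and curvature of the regularised function\<close>

abbreviation gx :: "'a \<Rightarrow> 'b \<Rightarrow> 'a" where "gx u v \<equiv> grad (\<lambda>u. f u v) u"
abbreviation gy :: "'a \<Rightarrow> 'b \<Rightarrow> 'b" where "gy u v \<equiv> grad (f u) v"
abbreviation F :: "real \<Rightarrow> 'a \<Rightarrow> 'b \<Rightarrow> 'a \<Rightarrow> real" where "F \<equiv> Freg f rx"

lemma closed_Y: "closed Y" using Y compact_imp_closed by blast

lemma gx_deriv: "GDERIV (\<lambda>u. f u v) u :> gx u v"
proof (rule GDERIV_grad)
  obtain D where "((\<lambda>(u, v). f u v) has_derivative D) (at (u, v))"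
    using diff unfolding differentiable_def by blast
  then have "((\<lambda>u. (\<lambda>(u, v). f u v) (u, v)) has_derivative (\<lambda>h. D (h, 0))) (at u)"
    by (rule has_derivative_compose[rotated]) (auto intro!: derivative_eq_intros)
  then show "(\<lambda>u. f u v) differentiable (at u)" unfolding differentiable_def by auto
qed

lemma gy_deriv: "GDERIV (f u) v :> gy u v"
proof (rule GDERIV_grad)
  obtain D where "((\<lambda>(u, v). f u v) has_derivative D) (at (u, v))"
    using diff unfolding differentiable_def by blast
  then have "((\<lambda>v. (\<lambda>(u, v). f u v) (u, v)) has_derivative (\<lambda>h. D (0, h))) (at v)"
    by (rule has_derivative_compose[rotated]) (auto intro!: derivative_eq_intros)
  then show "f u differentiable (at v)" unfolding differentiable_def by auto
qed

lemma grad_Freg_x: "grad (\<lambda>u. F r u v z) u = gx u v + rx *\<^sub>R (u - z)"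
proof (rule grad_eqI)
  have d: "((\<lambda>u. f u v) has_derivative (\<lambda>h. inner h (gx u v))) (at u)"
    using gx_deriv unfolding gderiv_def .
  show "GDERIV (\<lambda>u. F r u v z) u :> gx u v + rx *\<^sub>R (u - z)"
    unfolding gderiv_def Freg_def power2_norm_eq_inner
    by (rule derivative_eq_intros refl d)+ (auto simp: inner_simps inner_commute algebra_simps)
qed

lemma grad_Freg_y: "grad (\<lambda>v. F r u v z) v = gy u v - r *\<^sub>R v"
proof (rule grad_eqI)
  have d: "(f u has_derivative (\<lambda>h. inner h (gy u v))) (at v)"
    using gy_deriv unfolding gderiv_def .
  show "GDERIV (\<lambda>v. F r u v z) v :> gy u v - r *\<^sub>R v"
    unfolding gderiv_def Freg_def power2_norm_eq_inner
    by (rule derivative_eq_intros refl d)+ (auto simp: inner_simps inner_commute algebra_simps)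
qed

lemma gx_lip:
  assumes "u \<in> X" "u' \<in> X" "v \<in> Y" "v' \<in> Y"
  shows "norm (gx u v - gx u' v') \<le> L * (norm (u - u') + norm (v - v'))"
  using smooth assms unfolding smooth_on_def by blast

lemma gy_lip:
  assumes "u \<in> X" "u' \<in> X" "v \<in> Y" "v' \<in> Y"
  shows "norm (gy u v - gy u' v') \<le> L * (norm (u - u') + norm (v - v'))"
  using smooth assms unfolding smooth_on_def by blast

text \<open>Smoothness allows \<open>f\<close> curvature down to \<open>- L\<close> in
  \<open>x\<close>, and the proximal term adds exactly \<open>rx\<close>. This is strong convexity
  of modulus \<open>rx - L\<close>.\<close>

lemma F_x_lower:
  assumes "u \<in> X" "u' \<in> X" "v \<in> Y"
  shows "F r u' v z \<ge> F r u v z + inner (gx u v + rx *\<^sub>R (u - z)) (u' - u)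
    + (rx - L) / 2 * (norm (u' - u))\<^sup>2"
proof -
  have "f u' v \<ge> f u v + inner (gx u v) (u' - u) - L / 2 * (norm (u' - u))\<^sup>2"
    by (rule quadratic_lower_bound[OF X(3) assms(1,2) gx_deriv])
      (use gx_lip[OF _ _ assms(3) assms(3)] in auto)
  moreover have *: "(norm (u' - z))\<^sup>2 = (norm (u - z))\<^sup>2 + 2 * inner (u - z) (u' - u) + (norm (u' - u))\<^sup>2"
    using norm_add_sq[of "u - z" "u' - u"] by simp
  moreover have "inner (gx u v + rx *\<^sub>R (u - z)) (u' - u)
    = inner (gx u v) (u' - u) + rx * inner (u - z) (u' - u)" by (simp add: inner_add_left)
  ultimately show ?thesis unfolding Freg_def * by (simp add: field_simps)
qed

lemma F_x_upper:
  assumes "u \<in> X" "u' \<in> X" "v \<in> Y"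
  shows "F r u' v z \<le> F r u v z + inner (gx u v + rx *\<^sub>R (u - z)) (u' - u)
    + (rx + L) / 2 * (norm (u' - u))\<^sup>2"
proof -
  have "f u' v \<le> f u v + inner (gx u v) (u' - u) + L / 2 * (norm (u' - u))\<^sup>2"
    by (rule quadratic_upper_bound[OF X(3) assms(1,2) gx_deriv])
      (use gx_lip[OF _ _ assms(3) assms(3)] in auto)
  moreover have *: "(norm (u' - z))\<^sup>2 = (norm (u - z))\<^sup>2 + 2 * inner (u - z) (u' - u) + (norm (u' - u))\<^sup>2"
    using norm_add_sq[of "u - z" "u' - u"] by simp
  moreover have "inner (gx u v + rx *\<^sub>R (u - z)) (u' - u)
    = inner (gx u v) (u' - u) + rx * inner (u - z) (u' - u)" by (simp add: inner_add_left)
  ultimately show ?thesis unfolding Freg_def * by (simp add: field_simps)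
qed

lemma F_y_lower:
  assumes "u \<in> X" "v \<in> Y" "v' \<in> Y"
  shows "F r u v' z \<ge> F r u v z + inner (gy u v - r *\<^sub>R v) (v' - v) - (L + r) / 2 * (norm (v' - v))\<^sup>2"
proof -
  have "f u v' \<ge> f u v + inner (gy u v) (v' - v) - L / 2 * (norm (v' - v))\<^sup>2"
    by (rule quadratic_lower_bound[OF Y(3) assms(2,3) gy_deriv])
      (use gy_lip[OF assms(1) assms(1)] in auto)
  moreover have *: "(norm v')\<^sup>2 = (norm v)\<^sup>2 + 2 * inner v (v' - v) + (norm (v' - v))\<^sup>2"
    using norm_add_sq[of v "v' - v"] by simp
  moreover have "inner (gy u v - r *\<^sub>R v) (v' - v)
    = inner (gy u v) (v' - v) - r * inner v (v' - v)" by (simp add: inner_diff_left)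
  ultimately show ?thesis unfolding Freg_def * by (simp add: field_simps)
qed

text \<open>Concavity of \<open>f\<close> gives only the tangent bound. The modulus \<open>r\<close>
  comes entirely from the perturbation, so it degenerates as \<open>r\<close> tends to 0.\<close>

lemma F_y_upper:
  assumes "u \<in> X" "v \<in> Y" "v' \<in> Y"
  shows "F r u v' z \<le> F r u v z + inner (gy u v - r *\<^sub>R v) (v' - v) - r / 2 * (norm (v' - v))\<^sup>2"
proof -
  have "f u v' \<le> f u v + inner (gy u v) (v' - v)"
  proof (rule concave_on_le_tangent[OF concave[OF assms(1)] assms(2,3)])
    show "f u w \<le> f u v + inner (gy u v) (w - v) + L / 2 * (norm (w - v))\<^sup>2" if "w \<in> Y" for w
      by (rule quadratic_upper_bound[OF Y(3) assms(2) that gy_deriv])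
        (use gy_lip[OF assms(1) assms(1)] in auto)
  qed
  moreover have *: "(norm v')\<^sup>2 = (norm v)\<^sup>2 + 2 * inner v (v' - v) + (norm (v' - v))\<^sup>2"
    using norm_add_sq[of v "v' - v"] by simp
  moreover have "inner (gy u v - r *\<^sub>R v) (v' - v)
    = inner (gy u v) (v' - v) - r * inner v (v' - v)" by (simp add: inner_diff_left)
  ultimately show ?thesis unfolding Freg_def * by (simp add: field_simps)
qed

lemma F_z_diff:
  "F r u v z' - F r u v z = rx / 2 * inner (z' - z) (z' + z - 2 *\<^sub>R u)"
  unfolding Freg_def power2_norm_eq_inner
  by (simp add: inner_simps inner_commute algebra_simps)

lemma cont_f: "continuous_on S (\<lambda>(u, v). f u v)"
  by (intro differentiable_imp_continuous_on differentiable_at_imp_differentiable_on diff)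

lemma cont_F:
  assumes "continuous_on S g" "continuous_on S h"
  shows "continuous_on S (\<lambda>s. F r (g s) (h s) z)"
proof -
  have "continuous_on S (\<lambda>s. (\<lambda>(u, v). f u v) (g s, h s))"
    by (rule continuous_on_compose2[OF cont_f[of UNIV]]) (auto intro!: continuous_intros assms)
  then show ?thesis unfolding Freg_def by (auto intro!: continuous_intros assms)
qed

section \<open>The inner minimiser and its Lipschitz dependence on \<open>y\<close> and
  \<open>z\<close>\<close>

abbreviation xm :: "real \<Rightarrow> 'b \<Rightarrow> 'a \<Rightarrow> 'a" where "xm \<equiv> xmin f X rx"

text \<open>\<open>X\<close> may be unbounded. By strong convexity, points farther than
  \<open>R\<close> from \<open>u0\<close> have no smaller value than \<open>u0\<close>, so
  minimising over a compact ball suffices.\<close>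

lemma F_x_attains_min:
  assumes v: "v \<in> Y"
  shows "\<exists>p\<in>X. \<forall>u\<in>X. F r p v z \<le> F r u v z"
proof -
  obtain u0 where u0: "u0 \<in> X" using X by blast
  define G where "G = gx u0 v + rx *\<^sub>R (u0 - z)"
  define R where "R = 2 * norm G / (rx - L)"
  have m: "rx - L > 0" using rx L_pos by simp
  have R: "0 \<le> R" using m by (simp add: R_def)
  have "\<exists>p\<in>X \<inter> cball u0 R. \<forall>u\<in>X \<inter> cball u0 R. F r p v z \<le> F r u v z"
    by (rule continuous_attains_inf)
      (use X u0 R in \<open>auto intro!: cont_F continuous_intros closed_Int_compact\<close>)
  then obtain p where p: "p \<in> X" "\<And>u. u \<in> X \<inter> cball u0 R \<Longrightarrow> F r p v z \<le> F r u v z" by blast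
  have "F r p v z \<le> F r u v z" if u: "u \<in> X" for u
  proof (cases "u \<in> cball u0 R")
    case False
    then have far: "norm (u - u0) > R" by (simp add: dist_norm norm_minus_commute)
    have "\<bar>inner G (u - u0)\<bar> \<le> norm G * norm (u - u0)" by (rule Cauchy_Schwarz_ineq2)
    then have "F r u v z \<ge> F r u0 v z + (norm (u - u0) * ((rx - L) / 2 * norm (u - u0) - norm G))"
      using F_x_lower[OF u0 u v, of r z] unfolding G_def[symmetric]
      by (simp add: power2_eq_square algebra_simps)
    moreover have "(rx - L) / 2 * norm (u - u0) - norm G \<ge> 0"
      using far m by (simp add: R_def field_simps)
    ultimately have "F r u v z \<ge> F r u0 v z"
      by (smt (verit) mult_nonneg_nonneg norm_ge_zero)
    moreover have "F r p v z \<le> F r u0 v z" using p(2) u0 R by simp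
    ultimately show ?thesis by simp
  qed (use p u in auto)
  then show ?thesis using p by blast
qed

lemma
  assumes v: "v \<in> Y"
  shows xm_in: "xm r v z \<in> X"
    and xm_le: "u \<in> X \<Longrightarrow> F r (xm r v z) v z \<le> F r u v z"
proof -
  have "\<exists>p. is_arg_min (\<lambda>u. F r u v z) (\<lambda>u. u \<in> X) p"
    using F_x_attains_min[OF v, of r z] by (auto simp: is_arg_min_linorder)
  then have "is_arg_min (\<lambda>u. F r u v z) (\<lambda>u. u \<in> X) (xm r v z)"
    unfolding xmin_def arg_min_def by (rule someI_ex)
  then show "xm r v z \<in> X" "u \<in> X \<Longrightarrow> F r (xm r v z) v z \<le> F r u v z"
    by (auto simp: is_arg_min_linorder)
qed

lemma xm_optimality:
  assumes v: "v \<in> Y" and u: "u \<in> X"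
  shows "0 \<le> inner (gx (xm r v z) v + rx *\<^sub>R (xm r v z - z)) (u - xm r v z)"
  by (rule first_order_optimality[OF X(3) xm_in[OF v] u, where \<phi> = "\<lambda>u. F r u v z"])
    (rule xm_le[OF v], assumption, rule F_x_upper[OF xm_in[OF v] _ v])

text \<open>Strong convexity with the linear term removed by optimality. Most later comparisons use
  it in this form; it also makes the minimiser unique.\<close>

lemma xm_growth:
  assumes v: "v \<in> Y" and u: "u \<in> X"
  shows "F r u v z \<ge> F r (xm r v z) v z + (rx - L) / 2 * (norm (u - xm r v z))\<^sup>2"
  using F_x_lower[OF xm_in[OF v] u v, of r r z z] xm_optimality[OF v u, of r z] by linarith

text \<open>Growth at \<open>v'\<close> and strong convexity at \<open>v'\<close> make the gradient
  strongly monotone between the two minimisers. Optimality at \<open>v\<close> leaves only a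
  difference of gradients of \<open>f\<close> in the second argument.\<close>

lemma xm_lip_y:
  assumes v: "v \<in> Y" "v' \<in> Y"
  shows "(rx - L) * norm (xm r v z - xm r v' z) \<le> L * norm (v - v')"
proof -
  define u u' where uu: "u = xm r v z" "u' = xm r v' z"
  have in_X: "u \<in> X" "u' \<in> X" using xm_in v by (auto simp: uu)
  have 1: "F r u' v' z + (rx - L) / 2 * (norm (u - u'))\<^sup>2 \<le> F r u v' z"
    using xm_growth[OF v(2) in_X(1), of r z] by (simp add: uu)
  have 2: "F r u' v' z \<ge> F r u v' z + inner (gx u v' + rx *\<^sub>R (u - z)) (u' - u)
    + (rx - L) / 2 * (norm (u' - u))\<^sup>2" by (rule F_x_lower[OF in_X v(2)])
  have "(rx - L) * (norm (u - u'))\<^sup>2 \<le> inner (gx u v' + rx *\<^sub>R (u - z)) (u - u')"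
    using 1 2 by (simp add: norm_minus_commute inner_diff_right)
  also have "\<dots> \<le> inner (gx u v' - gx u v) (u - u')"
    using xm_optimality[OF v(1) in_X(2), of r z] unfolding uu(1)[symmetric]
    by (simp add: inner_simps)
  also have "\<dots> \<le> norm (gx u v' - gx u v) * norm (u - u')" by (rule norm_cauchy_schwarz)
  also have "\<dots> \<le> L * norm (v - v') * norm (u - u')"
    using gx_lip[OF in_X(1) in_X(1) v(2) v(1)] by (intro mult_right_mono) (auto simp: norm_minus_commute)
  finally have *: "((rx - L) * norm (u - u')) * norm (u - u') \<le> (L * norm (v - v')) * norm (u - u')"
    by (simp add: power2_eq_square mult_ac)
  show ?thesis unfolding uu[symmetric]
  proof (cases "norm (u - u') = 0")
    case False
    then show "(rx - L) * norm (u - u') \<le> L * norm (v - v')"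
      using * by (smt (verit) mult_right_le_imp_le norm_ge_zero)
  qed (use L_pos in simp)
qed

text \<open>Covers both the minimiser for a fixed \<open>y\<close> (\<open>v = v'\<close>) and the saddle point, which satisfies the
  two extra inequalities.\<close>

lemma xm_lip_z:
  assumes v: "v \<in> Y" "v' \<in> Y"
    and le: "F r (xm r v z) v' z \<le> F r (xm r v z) v z"
      "F r (xm r v' z') v z' \<le> F r (xm r v' z') v' z'"
  shows "(rx - L) * norm (xm r v z - xm r v' z') \<le> rx * norm (z - z')"
proof -
  define u u' where uu: "u = xm r v z" "u' = xm r v' z'"
  have in_X: "u \<in> X" "u' \<in> X" using xm_in v by (auto simp: uu)
  have "F r u v z + (rx - L) / 2 * (norm (u - u'))\<^sup>2 \<le> F r u' v z"
    "F r u' v' z' + (rx - L) / 2 * (norm (u - u'))\<^sup>2 \<le> F r u v' z'"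
    using xm_growth[OF v(2) in_X(1), of r z'] xm_growth[OF v(1) in_X(2), of r z]
    by (simp_all add: uu norm_minus_commute)
  \<comment> \<open>Add the two growth inequalities. The hypotheses \<open>le\<close> exchange
    \<open>v\<close> and \<open>v'\<close> where needed, so that each bracket varies
    \<open>z\<close> only and \<open>f\<close> cancels.\<close>
  then have "(rx - L) * (norm (u - u'))\<^sup>2 \<le> (F r u' v z - F r u' v z') - (F r u v' z - F r u v' z')"
    using le by (simp add: uu)
  also have "\<dots> = rx * inner (z - z') (u - u')"
    unfolding F_z_diff by (simp add: inner_simps algebra_simps)
  also have "\<dots> \<le> rx * (norm (z - z') * norm (u - u'))"
    using rx L_pos by (intro mult_left_mono norm_cauchy_schwarz) auto
  finally have *: "((rx - L) * norm (u - u')) * norm (u - u') \<le> (rx * norm (z - z')) * norm (u - u')"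
    by (simp add: power2_eq_square mult_ac)
  show ?thesis unfolding uu[symmetric]
  proof (cases "norm (u - u') = 0")
    case False
    then show "(rx - L) * norm (u - u') \<le> rx * norm (z - z')"
      using * by (smt (verit) mult_right_le_imp_le norm_ge_zero)
  qed (use L_pos rx in simp)
qed

text \<open>Since \<open>rx > 3 * L\<close>, the ratio \<open>L / (rx - L)\<close> is below 1/2. In
  the same way \<open>rx / (rx - L)\<close> is below 3/2 in \<open>norm_xm_diff_z\<close>.\<close>

lemma norm_xm_diff_y:
  assumes v: "v \<in> Y" "v' \<in> Y"
  shows "norm (xm r v z - xm r v' z) \<le> norm (v - v') / 2"
proof -
  have "2 * L * norm (xm r v z - xm r v' z) \<le> (rx - L) * norm (xm r v z - xm r v' z)"
    using rx by (intro mult_right_mono) auto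
  also have "\<dots> \<le> L * norm (v - v')" by (rule xm_lip_y[OF v])
  finally show ?thesis using L_pos by (simp add: field_simps)
qed

lemma norm_xm_diff_z:
  assumes v: "v \<in> Y" "v' \<in> Y"
    and le: "F r (xm r v z) v' z \<le> F r (xm r v z) v z"
      "F r (xm r v' z') v z' \<le> F r (xm r v' z') v' z'"
  shows "norm (xm r v z - xm r v' z') \<le> 3 / 2 * norm (z - z')"
proof -
  have "2 * rx / 3 * norm (xm r v z - xm r v' z') \<le> (rx - L) * norm (xm r v z - xm r v' z')"
    using rx by (intro mult_right_mono) auto
  also have "\<dots> \<le> rx * norm (z - z')" by (rule xm_lip_z[OF assms])
  finally show ?thesis using L_pos rx by (simp add: field_simps)
qed

section \<open>The dual function and the saddle point\<close>

definition dual :: "real \<Rightarrow> 'b \<Rightarrow> 'a \<Rightarrow> real" where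
  "dual r v z = F r (xm r v z) v z"

definition ystar :: "real \<Rightarrow> 'a \<Rightarrow> 'b" where
  "ystar r z = (SOME v. v \<in> Y \<and> (\<forall>w\<in>Y. dual r w z \<le> dual r v z))"

abbreviation xstar :: "real \<Rightarrow> 'a \<Rightarrow> 'a" where
  "xstar r z \<equiv> xm r (ystar r z) z"

text \<open>The inner minimiser is Lipschitz in \<open>v\<close>, so the dual function is continuous
  and attains its maximum on the compact set \<open>Y\<close>.\<close>

lemma ystar_in: "ystar r z \<in> Y"
  and dual_le_ystar: "v \<in> Y \<Longrightarrow> dual r v z \<le> dual r (ystar r z) z"
proof -
  have "(1 / 2)-lipschitz_on Y (\<lambda>v. xm r v z)"
    by (rule lipschitz_onI) (use norm_xm_diff_y in \<open>auto simp: dist_norm\<close>)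
  then have "continuous_on Y (\<lambda>v. dual r v z)"
    unfolding dual_def by (intro cont_F lipschitz_on_continuous_on continuous_intros)
  then have "\<exists>v. v \<in> Y \<and> (\<forall>w\<in>Y. dual r w z \<le> dual r v z)"
    using continuous_attains_sup[OF Y(2,1)] by blast
  from someI_ex[OF this, folded ystar_def]
  show "ystar r z \<in> Y" "v \<in> Y \<Longrightarrow> dual r v z \<le> dual r (ystar r z) z" by auto
qed

text \<open>Danskin-type argument without differentiating the dual function: comparing the values at
  \<open>ystar\<close> and at a nearby point \<open>v\<close> gives the first-order condition at \<open>v\<close>.\<close>

lemma ystar_optimality:
  assumes w: "w \<in> Y"
  shows "inner (gy (xstar r z) (ystar r z) - r *\<^sub>R ystar r z) (w - ystar r z) \<le> 0"
proof -
  define ys xs where "ys = ystar r z" and "xs = xstar r z"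
  have ys: "ys \<in> Y" and xs: "xs \<in> X" unfolding ys_def xs_def by (simp_all add: ystar_in xm_in)
  \<comment> \<open>Cost of transferring the condition from \<open>(u, v)\<close> to
    \<open>(xs, ys)\<close>: the factor 3/2 is 1 for the move of \<open>v\<close> plus 1/2 for the
    move of the inner minimiser, and \<open>\<bar>r\<bar>\<close> covers the perturbation.\<close>
  define C where "C = (L * (3 / 2) + \<bar>r\<bar>) * (norm (w - ys))\<^sup>2"
  have "inner (gy xs ys - r *\<^sub>R ys) (w - ys) \<le> 0"
  proof (rule le_if_le_add_small[where C = C])
    fix s :: real assume s: "0 < s" "s \<le> 1"
    define v where "v = ys + s *\<^sub>R (w - ys)"
    define u where "u = xm r v z"
    have v: "v \<in> Y" unfolding v_def
      using convexD_alt[OF Y(3) ys w] s by (simp add: algebra_simps)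
    have u: "u \<in> X" unfolding u_def by (rule xm_in[OF v])
    have "F r u v z \<le> F r xs ys z"
      using dual_le_ystar[OF v, of r z] by (simp add: dual_def u_def xs_def ys_def)
    also have "\<dots> \<le> F r u ys z"
      unfolding xs_def ys_def by (rule xm_le[OF ystar_in u])
    also have "\<dots> \<le> F r u v z + inner (gy u v - r *\<^sub>R v) (ys - v) - r / 2 * (norm (ys - v))\<^sup>2"
      by (rule F_y_upper[OF u v ys])
    finally have "- inner (gy u v - r *\<^sub>R v) (ys - v) + r / 2 * (norm (ys - v))\<^sup>2 \<le> 0" by simp
    moreover have ysv: "ys - v = - (s *\<^sub>R (w - ys))" by (simp add: v_def)
    ultimately have 1: "s * inner (gy u v - r *\<^sub>R v) (w - ys) \<le> s * (- r / 2 * s * (norm (w - ys))\<^sup>2)"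
      using s by (simp add: power2_eq_square mult_ac)
    then have 1: "inner (gy u v - r *\<^sub>R v) (w - ys) \<le> - r / 2 * s * (norm (w - ys))\<^sup>2"
      by (rule mult_left_le_imp_le[OF _ s(1)])
    have nv: "norm (ys - v) = s * norm (w - ys)" using s by (simp add: ysv norm_minus_commute)
    have nu: "norm (xs - u) \<le> s * norm (w - ys) / 2"
      using norm_xm_diff_y[OF ys v, of r z] by (simp add: xs_def u_def ys_def[symmetric] nv)
    have "norm (gy xs ys - gy u v) \<le> L * (norm (xs - u) + norm (ys - v))"
      by (rule gy_lip[OF xs u ys v])
    also have "\<dots> \<le> L * (s * norm (w - ys) / 2 + s * norm (w - ys))"
      using nu nv L_pos by (intro mult_left_mono) auto
    finally have "norm (gy xs ys - gy u v) * norm (w - ys) \<le> L * (3 / 2 * s * norm (w - ys)) * norm (w - ys)"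
      by (intro mult_right_mono) (auto simp: field_simps)
    with norm_cauchy_schwarz[of "gy xs ys - gy u v" "w - ys"]
    have 2: "inner (gy xs ys - gy u v) (w - ys) \<le> s * (L * (3 / 2) * (norm (w - ys))\<^sup>2)"
      by (simp add: power2_eq_square mult_ac)
    have "inner (gy xs ys - r *\<^sub>R ys) (w - ys)
      = inner (gy u v - r *\<^sub>R v) (w - ys) + inner (gy xs ys - gy u v) (w - ys) + s * r * (norm (w - ys))\<^sup>2"
      by (simp add: v_def inner_simps power2_norm_eq_inner algebra_simps)
    also have "\<dots> \<le> s * (L * (3 / 2) * (norm (w - ys))\<^sup>2) + s * (r / 2 * (norm (w - ys))\<^sup>2)"
      using 1 2 by (simp add: field_simps)
    also have "\<dots> \<le> s * (L * (3 / 2) * (norm (w - ys))\<^sup>2) + s * (\<bar>r\<bar> * (norm (w - ys))\<^sup>2)"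
      using s by (intro add_mono mult_left_mono mult_right_mono order_refl) auto
    finally show "inner (gy xs ys - r *\<^sub>R ys) (w - ys) \<le> 0 + s * C"
      by (simp add: C_def distrib_left distrib_right mult_ac)
  qed
  then show ?thesis by (simp add: xs_def ys_def)
qed

text \<open>\<open>ystar\<close> also maximises \<open>F\<close> for the fixed first argument
  \<open>xstar\<close>. Together with \<open>xm_growth\<close> this makes the pair a saddle point
  when \<open>r\<close> is nonnegative.\<close>

lemma ystar_growth:
  assumes w: "w \<in> Y"
  shows "F r (xstar r z) w z + r / 2 * (norm (w - ystar r z))\<^sup>2 \<le> F r (xstar r z) (ystar r z) z"
  using F_y_upper[of "xstar r z" "ystar r z" w r z] ystar_optimality[OF w, of r z]
  by (simp add: xm_in ystar_in w)

text \<open>The saddle property supplies the two exchange inequalities of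
  \<open>norm_xm_diff_z\<close>. The constant does not depend on \<open>r\<close>, so it survives
  the limit of vanishing perturbation.\<close>

lemma norm_xstar_diff:
  assumes "0 \<le> r"
  shows "norm (xstar r z - xstar r z') \<le> 3 / 2 * norm (z - z')"
proof (rule norm_xm_diff_z[OF ystar_in ystar_in])
  have nonneg: "0 \<le> r / 2 * t\<^sup>2" for t :: real using assms by simp
  show "F r (xstar r z) (ystar r z') z \<le> F r (xstar r z) (ystar r z) z"
    using ystar_growth[OF ystar_in, of r z r z'] nonneg[of "norm (ystar r z' - ystar r z)"] by linarith
  show "F r (xstar r z') (ystar r z) z' \<le> F r (xstar r z') (ystar r z') z'"
    using ystar_growth[OF ystar_in, of r z' r z] nonneg[of "norm (ystar r z - ystar r z')"] by linarith
qed

section \<open>Projection inequalities and error bounds\<close>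

lemma closest_point_inner:
  assumes "convex S" "closed S" "w \<in> S"
  shows "inner (p - closest_point S (p + g)) (w - closest_point S (p + g))
    \<le> - inner g (w - closest_point S (p + g))"
  using closest_point_dot[OF assms, of "p + g"] by (simp add: inner_simps)

lemma yplus_eq:
  "yplus f X Y rx r a v z = closest_point Y (v + a *\<^sub>R (gy (xm r v z) v - r *\<^sub>R v))"
  unfolding yplus_def grad_Freg_y ..

lemma yplus_in: "yplus f X Y rx r a v z \<in> Y"
  unfolding yplus_def by (rule closest_point_in_set[OF closed_Y Y(1)])

text \<open>The projection inequality makes \<open>vp\<close> an approximate maximiser of
  \<open>F\<close> at \<open>up\<close>, with first-order error \<open>K * \<delta> * D\<close>.
  Comparing the four values of \<open>F\<close> at \<open>up\<close>, \<open>xs\<close> against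
  \<open>vp\<close>, \<open>ys\<close> bounds a quadratic expression in the distances by this
  error.\<close>

lemma dual_error_bound_sq:
  fixes z :: 'a
  assumes v: "v \<in> Y" and r: "0 < r" and a: "0 < a"
  defines "vp \<equiv> yplus f X Y rx r a v z"
  shows "4 * r * (rx - L) * (norm (xstar r z - xm r vp z))\<^sup>2
    \<le> ((1 / a + 3 / 2 * (L + r)) * norm (v - vp))\<^sup>2"
proof -
  define u where "u = xm r v z"
  define up where "up = xm r vp z"
  define xs ys where "xs = xstar r z" and "ys = ystar r z"
  \<comment> \<open>In \<open>K\<close>, \<open>1 / a\<close> comes from the projection,
    \<open>3 / 2 * L\<close> from the change of gradient (1 for \<open>v\<close>, 1/2 for the inner
    minimiser) and \<open>r\<close> from the perturbation, rounded up to
    \<open>3 / 2 * r\<close>.\<close>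
  define K \<delta> D where "K = 1 / a + 3 / 2 * (L + r)" and "\<delta> = norm (v - vp)" and "D = norm (ys - vp)"
  have vp: "vp \<in> Y" unfolding vp_def by (rule yplus_in)
  have ys: "ys \<in> Y" by (simp add: ys_def ystar_in)
  have inX: "u \<in> X" "up \<in> X" "xs \<in> X" using xm_in v vp ystar_in by (auto simp: u_def up_def xs_def)
  define g where "g = gy u v - r *\<^sub>R v"
  have "inner (v - vp) (ys - vp) \<le> - inner (a *\<^sub>R g) (ys - vp)"
    using closest_point_inner[OF Y(3) closed_Y ys] unfolding vp_def yplus_eq g_def u_def .
  then have g: "inner g (ys - vp) \<le> 1 / a * inner (vp - v) (ys - vp)"
    using a by (simp add: field_simps inner_simps)
  have nu: "norm (up - u) \<le> \<delta> / 2"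
    using norm_xm_diff_y[OF vp v, of r z] by (simp add: up_def u_def \<delta>_def norm_minus_commute)
  have "norm (gy up vp - gy u v) \<le> L * (norm (up - u) + norm (vp - v))"
    by (rule gy_lip[OF inX(2) inX(1) vp v])
  also have "\<dots> \<le> L * (\<delta> / 2 + \<delta>)"
    using nu L_pos by (intro mult_left_mono add_mono) (auto simp: \<delta>_def norm_minus_commute)
  finally have ngy: "norm (gy up vp - gy u v) \<le> L * (\<delta> / 2 + \<delta>)" .
  have "inner (gy up vp - r *\<^sub>R vp) (ys - vp)
    = inner (gy up vp - gy u v) (ys - vp) + (- r) * inner (vp - v) (ys - vp) + inner g (ys - vp)"
    by (simp add: g_def inner_simps algebra_simps)
  also have "\<dots> \<le> L * (\<delta> / 2 + \<delta>) * D + r * (\<delta> * D) + 1 / a * (\<delta> * D)"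
  proof (intro add_mono)
    show "inner (gy up vp - gy u v) (ys - vp) \<le> L * (\<delta> / 2 + \<delta>) * D"
      using norm_cauchy_schwarz[of "gy up vp - gy u v" "ys - vp"] ngy
      unfolding D_def by (rule order_trans[OF _ mult_right_mono]) simp
    have "inner (v - vp) (ys - vp) \<le> \<delta> * D"
      unfolding D_def \<delta>_def by (rule norm_cauchy_schwarz)
    then have "r * inner (v - vp) (ys - vp) \<le> r * (\<delta> * D)" using r by simp
    moreover have "- r * inner (vp - v) (ys - vp) = r * inner (v - vp) (ys - vp)"
      by (metis inner_minus_left minus_diff_eq mult_minus_left mult_minus_right)
    ultimately show "- r * inner (vp - v) (ys - vp) \<le> r * (\<delta> * D)" by simp
    have "inner (vp - v) (ys - vp) \<le> \<delta> * D"
      using norm_cauchy_schwarz[of "vp - v" "ys - vp"] by (simp add: D_def \<delta>_def norm_minus_commute)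
    then have "1 / a * inner (vp - v) (ys - vp) \<le> 1 / a * (\<delta> * D)"
      using a by (intro mult_left_mono) auto
    with g show "inner g (ys - vp) \<le> 1 / a * (\<delta> * D)" by linarith
  qed
  also have "\<dots> \<le> K * \<delta> * D"
  proof -
    have "0 \<le> r * \<delta> * D" using r by (simp add: \<delta>_def D_def)
    then show ?thesis by (simp add: K_def algebra_simps)
  qed
  finally have A: "inner (gy up vp - r *\<^sub>R vp) (ys - vp) \<le> K * \<delta> * D" .
  \<comment> \<open>The next four inequalities form a cycle: all values of \<open>F\<close> cancel
    in their sum, and each half modulus occurs twice.\<close>
  have "F r up ys z \<le> F r up vp z + K * \<delta> * D - r / 2 * D\<^sup>2"
    using F_y_upper[OF inX(2) vp ys, of r z] A by (simp add: D_def)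
  moreover have "F r xs vp z + r / 2 * D\<^sup>2 \<le> F r xs ys z"
    using ystar_growth[OF vp, of r z] by (simp add: xs_def ys_def D_def norm_minus_commute)
  moreover have "F r xs ys z + (rx - L) / 2 * (norm (xs - up))\<^sup>2 \<le> F r up ys z"
    using xm_growth[OF ys inX(2), of r z] by (simp add: xs_def ys_def norm_minus_commute)
  moreover have "F r up vp z + (rx - L) / 2 * (norm (xs - up))\<^sup>2 \<le> F r xs vp z"
    using xm_growth[OF vp inX(3), of r z] by (simp add: up_def)
  ultimately have B: "(rx - L) * (norm (xs - up))\<^sup>2 + r * D\<^sup>2 \<le> K * \<delta> * D" by (simp add: field_simps)
  \<comment> \<open>Completing the square eliminates the unknown distance \<open>D\<close>; this
    produces the factor \<open>1 / sqrt r\<close> of the error bound.\<close>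
  have "4 * r * ((rx - L) * (norm (xs - up))\<^sup>2) \<le> 4 * r * (K * \<delta> * D - r * D\<^sup>2)"
    using B r by (intro mult_left_mono) auto
  also have "\<dots> \<le> (K * \<delta>)\<^sup>2"
    using zero_le_power2[of "K * \<delta> - 2 * r * D"] by (simp add: power2_eq_square algebra_simps)
  finally show ?thesis unfolding K_def \<delta>_def xs_def up_def by (simp only: mult.assoc)
qed

text \<open>Compares the previous constant with \<open>omega\<close>: \<open>4 * (rx - L)\<close> is
  replaced by the smaller \<open>m\<close>, and \<open>K * (a * m)\<close> is at most the numerator
  in \<open>omega\<close>.\<close>

lemma dual_error_bound:
  fixes z :: 'a
  assumes v: "v \<in> Y" and r: "0 < r" "r < rx - L" and a: "0 < a"
  defines "vp \<equiv> yplus f X Y rx r a v z"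
  shows "norm (xstar r z - xm r vp z) \<le> omega L rx r a * norm (v - vp)"
proof -
  define m where "m = rx - L - r"
  define K where "K = 1 / a + 3 / 2 * (L + r)"
  define e where "e = norm (xstar r z - xm r vp z)"
  have m: "0 < m" using r by (simp add: m_def)
  have K: "0 < K" using a r L_pos by (simp add: K_def add_pos_pos)
  have "r * m * e\<^sup>2 \<le> 4 * r * (rx - L) * e\<^sup>2"
    using r L_pos rx by (intro mult_right_mono mult_mono) (auto simp: m_def)
  also have "\<dots> \<le> (K * norm (v - vp))\<^sup>2"
    using dual_error_bound_sq[OF v r(1) a, of z] by (simp add: e_def K_def vp_def)
  finally have "(sqrt (r * m) * e)\<^sup>2 \<le> (K * norm (v - vp))\<^sup>2"
    using r m by (simp add: power_mult_distrib)
  then have "sqrt (r * m) * e \<le> K * norm (v - vp)"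
    by (rule power2_le_imp_le) (use K in simp)
  then have 1: "e \<le> K / sqrt (r * m) * norm (v - vp)"
    using r m by (simp add: field_simps)
  have "K / sqrt (r * m) \<le> omega L rx r a"
  proof -
    have pw: "m powr (3 / 2) = m * sqrt m"
      using m powr_add[of m 1 "1/2"] by (simp add: powr_half_sqrt)
    have "K * (a * m) = m + 3 / 2 * (a * (L + r)) * m" using a by (simp add: K_def field_simps)
    also have "\<dots> \<le> m + (a * (L + r)) * (3 * rx - 2 * L - 2 * r)"
    proof -
      have "3 / 2 * m \<le> 3 * rx - 2 * L - 2 * r" using m L_pos r by (simp add: m_def)
      then have "(a * (L + r)) * (3 / 2 * m) \<le> (a * (L + r)) * (3 * rx - 2 * L - 2 * r)"
        using a L_pos r by (intro mult_left_mono) auto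
      then show ?thesis by (simp add: mult_ac)
    qed
    finally have "K \<le> (m + a * (L + r) * (3 * rx - 2 * L - 2 * r)) / (a * m)"
      using a m by (simp add: pos_le_divide_eq)
    then have "K / sqrt (r * m) \<le> (m + a * (L + r) * (3 * rx - 2 * L - 2 * r)) / (a * m) / sqrt (r * m)"
      using r m by (intro divide_right_mono) auto
    also have "\<dots> = omega L rx r a"
      unfolding omega_def m_def[symmetric] pw by (simp add: real_sqrt_mult mult_ac)
    finally show ?thesis .
  qed
  then have "K / sqrt (r * m) * norm (v - vp) \<le> omega L rx r a * norm (v - vp)"
    by (rule mult_right_mono) simp
  with 1 show ?thesis unfolding e_def by (rule order_trans)
qed

text \<open>The upper model at \<open>u\<close>, strong convexity at \<open>u\<close>, growth at the
  minimiser and the projection inequality give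
  \<open>q * (e\<^sup>2 + D\<^sup>2) \<le> D\<^sup>2 - e\<^sup>2\<close>. Hence
  \<open>(1 + q) * e \<le> D\<close>, and the triangle inequality
  \<open>D \<le> \<Delta> + e\<close> leaves the step length alone.\<close>

lemma xstep_error:
  fixes z :: 'a
  assumes u: "u \<in> X" and v: "v \<in> Y" and c: "0 < c" "c * (rx + L) \<le> 1"
  defines "u1 \<equiv> closest_point X (u - c *\<^sub>R (gx u v + rx *\<^sub>R (u - z)))"
  shows "c * (rx - L) * norm (u1 - xm r v z) \<le> norm (u1 - u)"
proof -
  define G where "G = gx u v + rx *\<^sub>R (u - z)"
  define p where "p = xm r v z"
  define q where "q = c * (rx - L)"
  define e where "e = norm (u1 - p)"
  define D where "D = norm (u - p)"
  define \<Delta> where "\<Delta> = norm (u1 - u)"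
  have q: "0 < q" using c rx L_pos by (simp add: q_def)
  have u1: "u1 \<in> X" unfolding u1_def by (rule closest_point_in_set[OF X(2,1)])
  have p: "p \<in> X" unfolding p_def by (rule xm_in[OF v])
  have "inner (u - u1) (p - u1) \<le> - inner (- c *\<^sub>R G) (p - u1)"
    using closest_point_inner[OF X(3,2) p, of u "- c *\<^sub>R G"] by (simp add: u1_def G_def)
  then have proj: "c * inner G (u1 - p) \<le> inner (u - u1) (u1 - p)" by (simp add: inner_simps algebra_simps)
  have "F r u1 v z \<le> F r u v z + inner G (u1 - u) + (rx + L) / 2 * \<Delta>\<^sup>2"
    unfolding G_def \<Delta>_def by (rule F_x_upper[OF u u1 v])
  moreover have "F r p v z \<ge> F r u v z + inner G (p - u) + (rx - L) / 2 * D\<^sup>2"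
    using F_x_lower[OF u p v, of r z] by (simp add: G_def D_def norm_minus_commute)
  moreover have "F r u1 v z \<ge> F r p v z + (rx - L) / 2 * e\<^sup>2"
    unfolding e_def p_def by (rule xm_growth[OF v u1])
  moreover have "inner G (u1 - u) - inner G (p - u) = inner G (u1 - p)" by (simp add: inner_simps)
  ultimately have "(rx - L) / 2 * (e\<^sup>2 + D\<^sup>2) \<le> inner G (u1 - p) + (rx + L) / 2 * \<Delta>\<^sup>2"
    by (simp add: field_simps)
  then have "2 * c * ((rx - L) / 2 * (e\<^sup>2 + D\<^sup>2)) \<le> 2 * c * (inner G (u1 - p) + (rx + L) / 2 * \<Delta>\<^sup>2)"
    using c by (intro mult_left_mono) auto
  also have "\<dots> = 2 * (c * inner G (u1 - p)) + c * (rx + L) * \<Delta>\<^sup>2"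
    by (simp add: algebra_simps add_divide_distrib)
  also have "\<dots> \<le> 2 * inner (u - u1) (u1 - p) + \<Delta>\<^sup>2"
    using proj mult_right_mono[OF c(2), of "\<Delta>\<^sup>2"] by simp
  also have "\<dots> = D\<^sup>2 - e\<^sup>2"
    using norm_add_sq[of "u - u1" "u1 - p"] by (simp add: D_def e_def \<Delta>_def norm_minus_commute)
  finally have "q * (e\<^sup>2 + D\<^sup>2) \<le> D\<^sup>2 - e\<^sup>2" by (simp add: q_def)
  then have "(1 + q) * e\<^sup>2 \<le> (1 - q) * D\<^sup>2" by (simp add: algebra_simps)
  \<comment> \<open>The factor \<open>1 + q\<close> turns the left side into a square, while
    \<open>(1 + q) * (1 - q)\<close> is at most 1.\<close>
  then have "(1 + q) * ((1 + q) * e\<^sup>2) \<le> (1 + q) * ((1 - q) * D\<^sup>2)" using q by (intro mult_left_mono) auto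
  also have "\<dots> = D\<^sup>2 - q\<^sup>2 * D\<^sup>2" by (simp add: power2_eq_square algebra_simps)
  also have "\<dots> \<le> D\<^sup>2" by simp
  finally have "((1 + q) * e)\<^sup>2 \<le> D\<^sup>2" by (simp add: power2_eq_square mult_ac)
  then have "(1 + q) * e \<le> D" by (rule power2_le_imp_le) (simp add: D_def)
  also have "D \<le> \<Delta> + e" unfolding D_def \<Delta>_def e_def
    using norm_triangle_ineq[of "u - u1" "u1 - p"] by (simp add: norm_minus_commute)
  finally show ?thesis by (simp add: q_def e_def p_def \<Delta>_def algebra_simps)
qed

end

section \<open>Descent of the potential\<close>

text \<open>Every cross term is split by AM-GM; \<open>k\<close> bounds the ratio of \<open>\<parallel>x\<^sup>t\<^sup>+\<^sup>1 - x(y\<^sup>t,z\<^sup>t)\<parallel>\<close> to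
  \<open>dx = \<parallel>x\<^sup>t\<^sup>+\<^sup>1 - x\<^sup>t\<parallel>\<close>.\<close>

lemma descent_arith:
  fixes dx dy w P c a b k om L r rx :: real
  assumes nonneg: "0 \<le> dx" "0 \<le> dy" "0 \<le> w" "0 \<le> P" "0 \<le> k"
    and pos: "0 < c" "0 < a" "0 < b" "0 < L" "0 < r" "0 < rx"
    and P: "P \<le> dy + a * L * k * dx"
    and ak: "4 * a * L * k\<^sup>2 \<le> 1"
    and c: "4 * c * L \<le> 1" "c * rx \<le> 1"
    and a: "11 * a * (L + r) \<le> 1"
    and b: "b \<le> 1 / 36"
    and om: "384 * rx * a * b * om\<^sup>2 \<le> 1"
  shows "1 / (8 * c) * dx\<^sup>2 + 1 / (16 * a) * P\<^sup>2 + rx * b / 8 * w\<^sup>2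
    \<le> 1 / (2 * c) * dx\<^sup>2 - 2 * L * k * dx * dy + 1 / a * dy\<^sup>2 - 3 / 2 * (L + r) * dy\<^sup>2
      + rx * b * (1 - b / 2) * w\<^sup>2
      - 2 * rx * b * w * (9 / 2 * b * w + om * P + a * L * k / 2 * dx)"
proof -
  have alk: "a * L * k\<^sup>2 \<le> 1 / 4" using ak by simp
  have aL: "a * L \<le> 1 / 11"
  proof -
    have "0 \<le> a * r" using pos by simp
    then show ?thesis using a by (simp add: algebra_simps)
  qed
  have ic: "4 * L \<le> 1 / c" "rx \<le> 1 / c" using c pos by (simp_all add: field_simps)
  have akdx: "(a * L * k * dx)\<^sup>2 \<le> a * (L / 4 * dx\<^sup>2)"
  proof -
    have "(a * L * k * dx)\<^sup>2 = (a * L * k\<^sup>2) * (a * L * dx\<^sup>2)" by (simp add: power2_eq_square)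
    also have "\<dots> \<le> 1 / 4 * (a * L * dx\<^sup>2)" using alk pos by (intro mult_right_mono) auto
    also have "\<dots> = a * (L / 4 * dx\<^sup>2)" by simp
    finally show ?thesis .
  qed
  have cross_xy: "2 * L * k * dx * dy \<le> 1 / (4 * c) * dx\<^sup>2 + 1 / (4 * a) * dy\<^sup>2"
  proof -
    have "(2 * L * k * dx) * dy \<le> a * (2 * L * k * dx)\<^sup>2 + 1 / (4 * a) * dy\<^sup>2"
      by (rule two_mult_le_sq) (use pos in auto)
    also have "a * (2 * L * k * dx)\<^sup>2 = 4 * L * (a * L * k\<^sup>2) * dx\<^sup>2" by (simp add: power2_eq_square)
    also have "4 * L * (a * L * k\<^sup>2) * dx\<^sup>2 \<le> 4 * L * (1 / 4) * dx\<^sup>2"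
      using alk pos by (intro mult_right_mono mult_left_mono) auto
    also have "\<dots> \<le> 1 / (4 * c) * dx\<^sup>2" using ic by (intro mult_right_mono) (auto simp: field_simps)
    finally show ?thesis by simp
  qed
  have P2: "1 / a * P\<^sup>2 \<le> 2 / a * dy\<^sup>2 + L / 2 * dx\<^sup>2"
  proof -
    have "P\<^sup>2 \<le> (dy + a * L * k * dx)\<^sup>2" using P nonneg by (intro power_mono) auto
    also have "\<dots> \<le> 2 * dy\<^sup>2 + 2 * (a * L * k * dx)\<^sup>2"
      using zero_le_power2[of "dy - a * L * k * dx"] by (simp add: power2_eq_square algebra_simps)
    also have "\<dots> \<le> 2 * dy\<^sup>2 + 2 * (a * (L / 4 * dx\<^sup>2))" using akdx by linarith
    finally have "1 / a * P\<^sup>2 \<le> 1 / a * (2 * dy\<^sup>2 + 2 * (a * (L / 4 * dx\<^sup>2)))"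
      using pos by (intro mult_left_mono) auto
    then show ?thesis using pos by (simp add: field_simps)
  qed
  have dy_term: "3 / 2 * (L + r) * dy\<^sup>2 \<le> 3 / 22 * (1 / a * dy\<^sup>2)"
  proof -
    have "L + r \<le> 1 / (11 * a)" using a pos by (simp add: field_simps)
    then have "3 / 2 * (L + r) * dy\<^sup>2 \<le> 3 / 2 * (1 / (11 * a)) * dy\<^sup>2"
      by (intro mult_right_mono mult_left_mono) auto
    then show ?thesis by simp
  qed
  have w1: "2 * rx * b * w * (9 / 2 * b * w) \<le> 1 / 4 * (rx * b * w\<^sup>2)"
  proof -
    have "2 * rx * b * w * (9 / 2 * b * w) = 9 * b * (rx * b * w\<^sup>2)" by (simp add: power2_eq_square)
    also have "\<dots> \<le> 1 / 4 * (rx * b * w\<^sup>2)" using b pos by (intro mult_right_mono) auto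
    finally show ?thesis .
  qed
  have w2: "2 * rx * b * w * (om * P) \<le> 1 / 4 * (rx * b * w\<^sup>2) + 1 / 96 * (1 / a * P\<^sup>2)"
  proof -
    \<comment> \<open>The constant 384 in \<open>om\<close> is 4 times 96: the 4 comes from this
      square, and 1/96 is the share of \<open>1 / a * P\<^sup>2\<close> that remains.\<close>
    have "w * (2 * om * P) \<le> 1 / 4 * w\<^sup>2 + 1 * (2 * om * P)\<^sup>2"
      by (rule two_mult_le_sq) auto
    then have "rx * b * (w * (2 * om * P)) \<le> rx * b * (1 / 4 * w\<^sup>2 + 1 * (2 * om * P)\<^sup>2)"
      using pos by (intro mult_left_mono) auto
    also have "\<dots> = 1 / 4 * (rx * b * w\<^sup>2) + (384 * rx * a * b * om\<^sup>2) * (1 / 96 * (1 / a * P\<^sup>2))"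
      using pos by (simp add: power2_eq_square field_simps)
    also have "(384 * rx * a * b * om\<^sup>2) * (1 / 96 * (1 / a * P\<^sup>2)) \<le> 1 * (1 / 96 * (1 / a * P\<^sup>2))"
      using om pos by (intro mult_right_mono) auto
    finally show ?thesis by (simp add: mult_ac)
  qed
  have w3: "2 * rx * b * w * (a * L * k / 2 * dx) \<le> 1 / 4 * (rx * b * w\<^sup>2) + 1 / 1584 * (1 / c * dx\<^sup>2)"
  proof -
    have "w * (a * L * k * dx) \<le> 1 / 4 * w\<^sup>2 + 1 * (a * L * k * dx)\<^sup>2"
      by (rule two_mult_le_sq) auto
    also have "(a * L * k * dx)\<^sup>2 \<le> (a * L) * (1 / 4 * dx\<^sup>2)" using akdx by (simp add: mult.commute mult.left_commute)
    also have "(a * L) * (1 / 4 * dx\<^sup>2) \<le> 1 / 11 * (1 / 4 * dx\<^sup>2)" using aL by (intro mult_right_mono) auto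
    finally have "w * (a * L * k * dx) \<le> 1 / 4 * w\<^sup>2 + 1 / 44 * dx\<^sup>2" by simp
    then have "rx * b * (w * (a * L * k * dx)) \<le> rx * b * (1 / 4 * w\<^sup>2 + 1 / 44 * dx\<^sup>2)"
      using pos by (intro mult_left_mono) auto
    also have "\<dots> = 1 / 4 * (rx * b * w\<^sup>2) + b * rx * (1 / 44 * dx\<^sup>2)" by (simp add: algebra_simps)
    also have "b * rx * (1 / 44 * dx\<^sup>2) \<le> 1 / 36 * (1 / c) * (1 / 44 * dx\<^sup>2)"
      using b ic pos by (intro mult_right_mono mult_mono) auto
    finally show ?thesis by (simp add: mult_ac)
  qed
  have w0: "71 / 72 * (rx * b * w\<^sup>2) \<le> rx * b * (1 - b / 2) * w\<^sup>2"
  proof -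
    have "71 / 72 * (rx * b * w\<^sup>2) \<le> (1 - b / 2) * (rx * b * w\<^sup>2)"
      using b pos by (intro mult_right_mono) auto
    then show ?thesis by (simp add: mult_ac)
  qed
  have Ldx: "L * dx\<^sup>2 \<le> 1 / 4 * (1 / c * dx\<^sup>2)"
  proof -
    have "L * dx\<^sup>2 \<le> (1 / 4 * (1 / c)) * dx\<^sup>2" using ic by (intro mult_right_mono) auto
    then show ?thesis by simp
  qed
  \<comment> \<open>In these units the claim is linear. The three cross terms with \<open>w\<close>
    take \<open>3 / 4 * W\<close> out of \<open>71 / 72 * W\<close>, which leaves the required
    \<open>W / 8\<close>; all of \<open>Q\<close> is paid from \<open>2 * B + A / 8\<close>.\<close>
  define A B W Q where "A = 1 / c * dx\<^sup>2" and "B = 1 / a * dy\<^sup>2" and "W = rx * b * w\<^sup>2" and "Q = 1 / a * P\<^sup>2"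
  have nn: "0 \<le> A" "0 \<le> B" "0 \<le> W" "0 \<le> Q" using pos by (auto simp: A_def B_def W_def Q_def)
  have "2 * rx * b * w * (9 / 2 * b * w + om * P + a * L * k / 2 * dx)
    \<le> 3 / 4 * W + 1 / 96 * Q + 1 / 1584 * A"
    using w1 w2 w3 unfolding A_def W_def Q_def by (simp add: distrib_left)
  moreover have "Q \<le> 2 * B + 1 / 8 * A" using P2 Ldx unfolding Q_def A_def B_def by simp
  moreover have "2 * L * k * dx * dy \<le> 1 / 4 * A + 1 / 4 * B" using cross_xy by (simp add: A_def B_def)
  moreover have "3 / 2 * (L + r) * dy\<^sup>2 \<le> 3 / 22 * B" using dy_term by (simp add: B_def)
  moreover have "71 / 72 * W \<le> rx * b * (1 - b / 2) * w\<^sup>2" using w0 by (simp add: W_def)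
  moreover have "1 / (8 * c) * dx\<^sup>2 = 1 / 8 * A" "1 / (2 * c) * dx\<^sup>2 = 1 / 2 * A" "1 / (16 * a) * P\<^sup>2 = 1 / 16 * Q"
    "rx * b / 8 * w\<^sup>2 = 1 / 8 * W" "1 / a * dy\<^sup>2 = B" by (simp_all add: A_def Q_def W_def B_def)
  ultimately show ?thesis using nn by linarith
qed

section \<open>Variation of the dual function and of the potential\<close>

context reg_minimax
begin

text \<open>A smoothness bound for the dual without its derivative. Passing from \<open>u\<close> to
  \<open>u'\<close> costs a gradient mismatch \<open>L * n * d\<close>, split by AM-GM; its part
  \<open>L * n\<^sup>2\<close> is paid by growth about \<open>u\<close>, since
  \<open>(rx - L) / 2\<close> exceeds \<open>L\<close>.\<close>

lemma dual_y_lower: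
  assumes v: "v \<in> Y" "v' \<in> Y" and r: "0 \<le> r"
  shows "dual r v z + inner (gy (xm r v z) v - r *\<^sub>R v) (v' - v) - 3 / 4 * (L + r) * (norm (v' - v))\<^sup>2
    \<le> dual r v' z"
proof -
  define u u' where uu: "u = xm r v z" "u' = xm r v' z"
  have in_X: "u \<in> X" "u' \<in> X" using xm_in v by (auto simp: uu)
  define n d where "n = norm (u' - u)" and "d = norm (v' - v)"
  have "- (norm (gy u' v - gy u v) * d) \<le> inner (gy u' v - gy u v) (v' - v)"
    using Cauchy_Schwarz_ineq2[of "gy u' v - gy u v" "v' - v"] by (simp add: d_def)
  moreover have "norm (gy u' v - gy u v) * d \<le> L * n * d"
    using gy_lip[OF in_X(2,1) v(1) v(1)] by (intro mult_right_mono) (auto simp: n_def d_def)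
  moreover have "L * n * d \<le> L * n\<^sup>2 + L / 4 * d\<^sup>2"
  proof -
    have "L * (n * d) \<le> L * (1 * n\<^sup>2 + 1 / 4 * d\<^sup>2)"
      using L_pos by (intro mult_left_mono two_mult_le_sq) auto
    then show ?thesis by (simp add: algebra_simps)
  qed
  moreover have "inner (gy u' v - r *\<^sub>R v) (v' - v)
    = inner (gy u v - r *\<^sub>R v) (v' - v) + inner (gy u' v - gy u v) (v' - v)"
    by (simp add: inner_simps)
  moreover have "L * n\<^sup>2 \<le> (rx - L) / 2 * n\<^sup>2"
    using rx by (intro mult_right_mono) auto
  moreover have "F r u v z + (rx - L) / 2 * n\<^sup>2 \<le> F r u' v z"
    using xm_growth[OF v(1) in_X(2), of r z] by (simp add: uu n_def)
  moreover have "F r u' v z + inner (gy u' v - r *\<^sub>R v) (v' - v) - (L + r) / 2 * d\<^sup>2 \<le> F r u' v' z"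
    unfolding d_def by (rule F_y_lower[OF in_X(2) v])
  moreover have "(L + r) / 2 * d\<^sup>2 + L / 4 * d\<^sup>2 \<le> 3 / 4 * (L + r) * d\<^sup>2"
  proof -
    have "((L + r) / 2 + L / 4) * d\<^sup>2 \<le> (3 / 4 * (L + r)) * d\<^sup>2"
      using r by (intro mult_right_mono) auto
    then show ?thesis by (simp add: distrib_right)
  qed
  ultimately show ?thesis unfolding dual_def uu[symmetric] d_def[symmetric] by linarith
qed

text \<open>Each inner minimiser is tested in the problem of the other, and \<open>F_z_diff\<close>
  evaluates the difference exactly.\<close>

lemma dual_z_diff:
  assumes v: "v \<in> Y"
  shows "rx / 2 * inner (z' - z) (z' + z - 2 *\<^sub>R xm r v z') \<le> dual r v z' - dual r v z"
    and "dual r v z' - dual r v z \<le> rx / 2 * inner (z' - z) (z' + z - 2 *\<^sub>R xm r v z)"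
  using xm_le[OF v xm_in[OF v], of r z r z'] xm_le[OF v xm_in[OF v], of r z' r z]
    F_z_diff[of r "xm r v z'" v z' z] F_z_diff[of r "xm r v z" v z' z]
  unfolding dual_def by linarith+

text \<open>It splits into two nonnegative gaps, primal \<open>F - d\<close> and dual
  \<open>q - d\<close>, plus \<open>q\<close>. With weight 2, the gain of the dual in the
  \<open>y\<close> step outweighs the rise of \<open>F\<close>.\<close>

definition potential :: "real \<Rightarrow> 'a \<Rightarrow> 'b \<Rightarrow> 'a \<Rightarrow> real" where
  "potential r u v z = F r u v z - 2 * dual r v z + 2 * dual r (ystar r z) z"

text \<open>The \<open>x\<close> step lowers \<open>F\<close>. The \<open>y\<close> step raises
  \<open>F\<close> by about \<open>inner g1 (v1 - v)\<close>, but twice the dual by about double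
  that amount. The \<open>z\<close> step lowers \<open>F\<close>, and the changes of
  \<open>- 2 d\<close> and \<open>2 q\<close> nearly cancel, up to the product of
  \<open>z1 - z\<close> and \<open>x2 - x1\<close>. \<open>descent_arith\<close> absorbs the
  errors.\<close>

lemma potential_descent:
  fixes z :: 'a
  assumes u: "u \<in> X" and v: "v \<in> Y" and r: "0 < r" "r < rx - L"
    and c: "0 < c" "c * (rx + L) \<le> 1"
    and a: "0 < a" "11 * a * (L + r) \<le> 1" "4 * a * L \<le> (c * (rx - L))\<^sup>2"
    and b: "0 < b" "b \<le> 1 / 36" "384 * rx * a * b * (omega L rx r a)\<^sup>2 \<le> 1"
  defines "u1 \<equiv> closest_point X (u - c *\<^sub>R (gx u v + rx *\<^sub>R (u - z)))"
  defines "v1 \<equiv> closest_point Y (v + a *\<^sub>R (gy u1 v - r *\<^sub>R v))"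
  defines "z1 \<equiv> z + b *\<^sub>R (u1 - z)"
  shows "1 / (8 * c) * (norm (u1 - u))\<^sup>2 + 1 / (16 * a) * (norm (v - yplus f X Y rx r a v z))\<^sup>2
      + rx * b / 8 * (norm (z - u1))\<^sup>2
    \<le> potential r u v z - potential r u1 v1 z1"
proof -
  define vp where "vp = yplus f X Y rx r a v z"
  define p where "p = xm r v z"
  define dx dy w P where "dx = norm (u1 - u)" and "dy = norm (v1 - v)" and "w = norm (u1 - z)"
    and "P = norm (v - vp)"
  \<comment> \<open>The factor by which \<open>xstep_error\<close> bounds the distance of
    \<open>u1\<close> from the inner minimiser \<open>p\<close>.\<close>
  define k where "k = 1 / (c * (rx - L))"
  define ys1 where "ys1 = ystar r z1"
  define x1 x2 where "x1 = xm r v1 z1" and "x2 = xm r ys1 z"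
  have rx_pos: "0 < rx" "0 < rx - L" using rx L_pos by auto
  have k: "0 < k" using c rx_pos by (simp add: k_def)
  have u1: "u1 \<in> X" unfolding u1_def by (rule closest_point_in_set[OF X(2,1)])
  have v1: "v1 \<in> Y" unfolding v1_def by (rule closest_point_in_set[OF closed_Y Y(1)])
  have vp: "vp \<in> Y" unfolding vp_def by (rule yplus_in)
  have p: "p \<in> X" unfolding p_def by (rule xm_in[OF v])
  have ys1: "ys1 \<in> Y" unfolding ys1_def by (rule ystar_in)
  have up: "norm (u1 - p) \<le> k * dx"
    using xstep_error[OF u v c, of z r] c rx_pos
    unfolding k_def dx_def p_def u1_def[symmetric] by (simp add: field_simps)
  define g1 g0 where "g1 = gy u1 v - r *\<^sub>R v" and "g0 = gy p v - r *\<^sub>R v"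
  have g10: "norm (g1 - g0) \<le> L * k * dx"
  proof -
    have "norm (g1 - g0) \<le> L * norm (u1 - p)"
      using gy_lip[OF u1 p v v] by (simp add: g1_def g0_def)
    also have "\<dots> \<le> L * (k * dx)" using up L_pos by (intro mult_left_mono) auto
    finally show ?thesis by simp
  qed
  \<comment> \<open>\<open>v1\<close> and \<open>vp\<close> are projections of gradient steps that
    differ only in using \<open>u1\<close> or the exact minimiser \<open>p\<close>; projection does
    not expand distances.\<close>
  have v1p: "norm (vp - v1) \<le> a * L * k * dx"
  proof -
    have "dist v1 vp \<le> dist (v + a *\<^sub>R g1) (v + a *\<^sub>R g0)"
      unfolding v1_def vp_def yplus_eq g1_def g0_def p_def
      by (rule closest_point_lipschitz[OF Y(3) closed_Y Y(1)])
    also have "\<dots> = a * norm (g1 - g0)" using a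
      by (simp add: dist_norm flip: scaleR_diff_right)
    also have "\<dots> \<le> a * (L * k * dx)" using g10 a by (intro mult_left_mono) auto
    finally show ?thesis by (simp add: dist_norm norm_minus_commute mult_ac)
  qed
  have P_le: "P \<le> dy + a * L * k * dx"
    using norm_triangle_ineq[of "v - v1" "v1 - vp"] v1p
    by (simp add: P_def dy_def norm_minus_commute)
  have z1z: "norm (z1 - z) = b * w" using b by (simp add: z1_def w_def)
  have prox_x: "1 / (2 * c) * dx\<^sup>2 \<le> F r u v z - F r u1 v z"
  proof -
    have "inner (u - u1) (u - u1) \<le> c * inner (gx u v + rx *\<^sub>R (u - z)) (u - u1)"
      using closest_point_inner[OF X(3,2) u, of u "- c *\<^sub>R (gx u v + rx *\<^sub>R (u - z))"]
      by (simp add: u1_def)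
    then have "1 / c * dx\<^sup>2 \<le> - inner (gx u v + rx *\<^sub>R (u - z)) (u1 - u)"
      using c by (simp add: dx_def power2_norm_eq_inner inner_diff_right inner_diff_left field_simps inner_commute)
    moreover have "F r u1 v z \<le> F r u v z + inner (gx u v + rx *\<^sub>R (u - z)) (u1 - u) + (rx + L) / 2 * dx\<^sup>2"
      unfolding dx_def by (rule F_x_upper[OF u u1 v])
    moreover have "(rx + L) / 2 * dx\<^sup>2 \<le> 1 / (2 * c) * dx\<^sup>2"
      using c by (intro mult_right_mono) (auto simp: field_simps)
    ultimately show ?thesis by (simp add: field_simps)
  qed
  have prox_y: "1 / a * dy\<^sup>2 \<le> inner g1 (v1 - v)"
  proof -
    have "inner (v - v1) (v - v1) \<le> - inner (a *\<^sub>R g1) (v - v1)"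
      using closest_point_inner[OF Y(3) closed_Y v, of v "a *\<^sub>R g1"]
      by (simp only: v1_def g1_def)
    also have "\<dots> = a * inner g1 (v1 - v)" by (simp add: inner_diff_right algebra_simps)
    finally have "dy\<^sup>2 \<le> a * inner g1 (v1 - v)"
      by (simp add: dy_def norm_minus_commute[of v1] power2_norm_eq_inner)
    then show ?thesis using a by (simp add: field_simps)
  qed
  have Fy: "F r u1 v1 z - F r u1 v z \<le> inner g1 (v1 - v)"
  proof -
    have "0 \<le> r / 2 * (norm (v1 - v))\<^sup>2" using r by simp
    then show ?thesis using F_y_upper[OF u1 v v1, of r z] by (simp add: g1_def)
  qed
  have Fz: "F r u1 v1 z1 - F r u1 v1 z = - (rx * b * (1 - b / 2) * w\<^sup>2)"
  proof -
    have dz: "z1 - z = b *\<^sub>R (u1 - z)" "z1 + z - 2 *\<^sub>R u1 = (b - 2) *\<^sub>R (u1 - z)"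
      by (simp_all add: z1_def algebra_simps scaleR_2)
    show ?thesis unfolding F_z_diff dz inner_scaleR_left inner_scaleR_right w_def power2_norm_eq_inner
      by (simp add: field_simps)
  qed
  have cross_xy: "- (L * k * dx * dy) \<le> inner (g0 - g1) (v1 - v)"
  proof -
    have "\<bar>inner (g0 - g1) (v1 - v)\<bar> \<le> norm (g0 - g1) * dy"
      unfolding dy_def by (rule Cauchy_Schwarz_ineq2)
    also have "\<dots> \<le> L * k * dx * dy"
      using g10 by (intro mult_right_mono) (auto simp: norm_minus_commute dy_def)
    finally show ?thesis by simp
  qed
  \<comment> \<open>A path of five legs through the saddle points of \<open>z1\<close> and
    \<open>z\<close> and the minimisers at \<open>vp\<close>. Three legs change \<open>z\<close> by
    \<open>b * w\<close> at rate 3/2, which gives 9/2; the middle leg is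
    \<open>dual_error_bound\<close>.\<close>
  have x12: "norm (x2 - x1) \<le> 9 / 2 * b * w + omega L rx r a * P + a * L * k / 2 * dx"
  proof -
    have 1: "norm (x2 - xstar r z1) \<le> 3 / 2 * norm (z1 - z)"
      using norm_xm_diff_z[OF ys1 ys1 order_refl order_refl, of r z z1]
      by (simp add: x2_def ys1_def norm_minus_commute)
    have 2: "norm (xstar r z1 - xstar r z) \<le> 3 / 2 * norm (z1 - z)"
      using norm_xstar_diff[of r z1 z] r by simp
    have 3: "norm (xstar r z - xm r vp z) \<le> omega L rx r a * P"
      unfolding P_def vp_def by (rule dual_error_bound[OF v r a(1)])
    have 4: "norm (xm r vp z - xm r vp z1) \<le> 3 / 2 * norm (z1 - z)"
      using norm_xm_diff_z[OF vp vp order_refl order_refl, of r z z1] by (simp add: norm_minus_commute)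
    have 5: "norm (xm r vp z1 - x1) \<le> a * L * k / 2 * dx"
      using norm_xm_diff_y[OF vp v1, of r z1] v1p by (simp add: x1_def)
    have "x2 - x1 = (x2 - xstar r z1) + (xstar r z1 - xstar r z) + (xstar r z - xm r vp z)
      + (xm r vp z - xm r vp z1) + (xm r vp z1 - x1)" by simp
    then have "norm (x2 - x1) \<le> norm (x2 - xstar r z1) + norm (xstar r z1 - xstar r z)
      + norm (xstar r z - xm r vp z) + norm (xm r vp z - xm r vp z1) + norm (xm r vp z1 - x1)"
      by (metis (no_types) norm_triangle_le order_refl add_mono)
    then show ?thesis using 1 2 3 4 5 unfolding z1z by linarith
  qed
  have cross_z: "- (2 * rx * b * w * (9 / 2 * b * w + omega L rx r a * P + a * L * k / 2 * dx))
    \<le> 2 * rx * inner (z1 - z) (x2 - x1)"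
  proof -
    have "\<bar>inner (z1 - z) (x2 - x1)\<bar> \<le> b * w * norm (x2 - x1)"
      using Cauchy_Schwarz_ineq2[of "z1 - z" "x2 - x1"] by (simp add: z1z)
    also have "\<dots> \<le> b * w * (9 / 2 * b * w + omega L rx r a * P + a * L * k / 2 * dx)"
      using x12 b by (intro mult_left_mono) (auto simp: w_def)
    finally have "2 * rx * \<bar>inner (z1 - z) (x2 - x1)\<bar>
      \<le> 2 * rx * (b * w * (9 / 2 * b * w + omega L rx r a * P + a * L * k / 2 * dx))"
      using rx_pos by (intro mult_left_mono) auto
    moreover have "- (2 * rx * \<bar>inner (z1 - z) (x2 - x1)\<bar>) \<le> 2 * rx * inner (z1 - z) (x2 - x1)"
      using rx_pos abs_ge_minus_self[of "inner (z1 - z) (x2 - x1)"]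
        mult_left_mono[of "- inner (z1 - z) (x2 - x1)" "\<bar>inner (z1 - z) (x2 - x1)\<bar>" "2 * rx"] by simp
    ultimately show ?thesis unfolding mult.assoc by linarith
  qed
  have dual_y: "dual r v z + inner g0 (v1 - v) - 3 / 4 * (L + r) * dy\<^sup>2 \<le> dual r v1 z"
    using dual_y_lower[OF v v1, of r z] r by (simp add: g0_def p_def dy_def)
  have dual_z: "rx / 2 * inner (z1 - z) (z1 + z - 2 *\<^sub>R x1) \<le> dual r v1 z1 - dual r v1 z"
    unfolding x1_def by (rule dual_z_diff(1)[OF v1])
  \<comment> \<open>The new maximiser \<open>ys1\<close> is only a competitor at the old
    \<open>z\<close>, so the change of the maximum is bounded by the change of the dual at fixed
    \<open>ys1\<close>.\<close>
  have opt_z: "dual r ys1 z1 - dual r (ystar r z) z \<le> rx / 2 * inner (z1 - z) (z1 + z - 2 *\<^sub>R x2)"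
    using dual_z_diff(2)[OF ys1, of r z1 z] dual_le_ystar[OF ys1, of r z] by (simp add: x2_def)
  have zz: "rx * inner (z1 - z) (z1 + z - 2 *\<^sub>R x1) - rx * inner (z1 - z) (z1 + z - 2 *\<^sub>R x2)
    = 2 * rx * inner (z1 - z) (x2 - x1)"
    by (simp add: inner_diff_right algebra_simps)
  have gg: "inner (g0 - g1) (v1 - v) = inner g0 (v1 - v) - inner g1 (v1 - v)"
    by (simp add: inner_diff_left)
  have "1 / (8 * c) * dx\<^sup>2 + 1 / (16 * a) * P\<^sup>2 + rx * b / 8 * w\<^sup>2
    \<le> 1 / (2 * c) * dx\<^sup>2 - 2 * L * k * dx * dy + 1 / a * dy\<^sup>2 - 3 / 2 * (L + r) * dy\<^sup>2
      + rx * b * (1 - b / 2) * w\<^sup>2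
      - 2 * rx * b * w * (9 / 2 * b * w + omega L rx r a * P + a * L * k / 2 * dx)"
  proof (rule descent_arith)
    have "4 * c * L \<le> c * (rx + L)" using rx c by simp
    then show "4 * c * L \<le> 1" using c by linarith
    have "c * rx \<le> c * (rx + L)" using L_pos c by simp
    then show "c * rx \<le> 1" using c by linarith
    show "4 * a * L * k\<^sup>2 \<le> 1" using a(3) c rx_pos by (simp add: k_def power_divide divide_le_eq)
  qed (use assms(3-12) L_pos rx_pos k P_le in \<open>auto simp: dx_def dy_def w_def P_def\<close>)
  also have "\<dots> \<le> potential r u v z - potential r u1 v1 z1"
    using prox_x prox_y Fy Fz cross_xy cross_z dual_y dual_z opt_z zz gg
    unfolding potential_def ys1_def[symmetric] by linarith
  finally show ?thesis by (simp add: dx_def P_def w_def vp_def norm_minus_commute)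
qed

text \<open>Lowering \<open>r\<close> raises \<open>F\<close> by at most
  \<open>B * (r - r') / 2\<close> on \<open>Y\<close>. This counts once for \<open>F\<close> and
  twice for the maximal dual value, hence 3/2; the dual with the negative sign only grows.\<close>

lemma potential_antimono_r:
  assumes v: "v \<in> Y" and r: "r' \<le> r" and B: "\<And>w. w \<in> Y \<Longrightarrow> (norm w)\<^sup>2 \<le> B"
  shows "potential r' u v z \<le> potential r u v z + 3 / 2 * B * (r - r')"
proof -
  have shift: "F r' u w z = F r u w z + (r - r') / 2 * (norm w)\<^sup>2" for u w
    by (simp add: Freg_def field_simps)
  have up: "F r' u w z \<le> F r u w z + B * (r - r') / 2" if "w \<in> Y" for u w
  proof -
    have "(r - r') / 2 * (norm w)\<^sup>2 \<le> (r - r') / 2 * B"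
      using B[OF that] r by (intro mult_left_mono) auto
    then show ?thesis by (simp add: shift mult.commute)
  qed
  have low: "F r u w z \<le> F r' u w z" for u w using r by (simp add: shift)
  have "dual r v z \<le> F r (xm r' v z) v z"
    unfolding dual_def by (rule xm_le[OF v xm_in[OF v]])
  also have "\<dots> \<le> dual r' v z" unfolding dual_def by (rule low)
  finally have 1: "dual r v z \<le> dual r' v z" .
  define w where "w = ystar r' z"
  have w: "w \<in> Y" unfolding w_def by (rule ystar_in)
  have "dual r' w z \<le> F r' (xm r w z) w z"
    unfolding dual_def by (rule xm_le[OF w xm_in[OF w]])
  also have "\<dots> \<le> dual r w z + B * (r - r') / 2" unfolding dual_def by (rule up[OF w])
  also have "\<dots> \<le> dual r (ystar r z) z + B * (r - r') / 2" using dual_le_ystar[OF w] by simp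
  finally have 2: "dual r' (ystar r' z) z \<le> dual r (ystar r z) z + B * (r - r') / 2"
    unfolding w_def .
  show ?thesis unfolding potential_def using 1 2 up[OF v, of u] by simp
qed

text \<open>Both gaps in the potential are nonnegative, so the maximal dual value remains. By the
  saddle property it bounds \<open>F\<close> at \<open>xstar\<close> over all of \<open>Y\<close>,
  and \<open>r \<le> r0\<close> allows comparison with the value for \<open>r0\<close>.\<close>

lemma potential_lower:
  assumes u: "u \<in> X" and v: "v \<in> Y" and r: "0 \<le> r" "r \<le> r0"
    and M: "\<And>u K. u \<in> X \<Longrightarrow> (\<And>w. w \<in> Y \<Longrightarrow> f u w - r0 / 2 * (norm w)\<^sup>2 \<le> K) \<Longrightarrow> M \<le> K"
  shows "M \<le> potential r u v z"
proof -
  have "M \<le> dual r (ystar r z) z"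
  proof (rule M[OF xm_in[OF ystar_in]])
    fix w assume w: "w \<in> Y"
    have "f (xstar r z) w - r0 / 2 * (norm w)\<^sup>2 \<le> f (xstar r z) w - r / 2 * (norm w)\<^sup>2"
      using r by (simp add: mult_right_mono)
    also have "\<dots> \<le> F r (xstar r z) w z" using rx L_pos by (simp add: Freg_def)
    also have "\<dots> \<le> F r (xstar r z) w z + r / 2 * (norm (w - ystar r z))\<^sup>2" using r by simp
    also have "\<dots> \<le> dual r (ystar r z) z"
      unfolding dual_def by (rule ystar_growth[OF w])
    finally show "f (xstar r z) w - r0 / 2 * (norm w)\<^sup>2 \<le> dual r (ystar r z) z" .
  qed
  moreover have "dual r v z \<le> F r u v z" unfolding dual_def by (rule xm_le[OF v u])
  moreover have "dual r v z \<le> dual r (ystar r z) z" by (rule dual_le_ystar[OF v])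
  ultimately show ?thesis unfolding potential_def by linarith
qed

end

section \<open>Limit points along the index set\<close>

lemma tendsto_zero_if_sq_le:
  fixes g :: "'i \<Rightarrow> 'a::real_normed_vector" and h :: "'i \<Rightarrow> real"
  assumes "eventually (\<lambda>j. (norm (g j))\<^sup>2 \<le> K * h j) A" "(h \<longlongrightarrow> 0) A"
  shows "(g \<longlongrightarrow> 0) A"
proof -
  have "((\<lambda>j. K * h j) \<longlongrightarrow> 0) A" using tendsto_mult_right_zero[OF assms(2)] .
  then have "((\<lambda>j. (norm (g j))\<^sup>2) \<longlongrightarrow> 0) A"
    by (rule tendsto_sandwich[of "\<lambda>_. 0", rotated 3]) (use assms(1) in auto)
  then have "((\<lambda>j. sqrt ((norm (g j))\<^sup>2)) \<longlongrightarrow> 0) A" using tendsto_real_sqrt by fastforce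
  then show ?thesis by (simp add: tendsto_norm_zero_iff)
qed

lemma le_mult_inverse_if:
  fixes N n K :: real
  assumes "N * n \<le> K" "0 < n"
  shows "N \<le> K * (1 / n)"
  using assms by (simp add: pos_le_divide_eq)

lemma tendsto_zero_if_norm_le:
  fixes g :: "'i \<Rightarrow> 'a::real_normed_vector" and h :: "'i \<Rightarrow> 'b::real_normed_vector"
  assumes "eventually (\<lambda>j. norm (g j) \<le> K * norm (h j)) A" "(h \<longlongrightarrow> 0) A"
  shows "(g \<longlongrightarrow> 0) A"
  by (rule Lim_null_comparison[OF assms(1)])
    (intro tendsto_mult_right_zero tendsto_norm_zero assms(2))

text \<open>The variational inequalities say that the negative gradient in \<open>x\<close>, and the
  gradient in \<open>y\<close>, are subgradients of the indicators, so 0 itself lies in both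
  sets.\<close>

lemma game_stationaryI:
  assumes "p \<in> X" "q \<in> Y"
    and X: "\<And>u. u \<in> X \<Longrightarrow> 0 \<le> inner (grad (\<lambda>u. f u q) p) (u - p)"
    and Y: "\<And>v. v \<in> Y \<Longrightarrow> inner (grad (f p) q) (v - q) \<le> 0"
  shows "game_stationary f X Y 0 (p, q)"
proof -
  have "- grad (\<lambda>u. f u q) p \<in> subdifferential (ind_fun X) p"
    using assms(1) X by (auto simp: subdifferential_def ind_fun_def zero_ereal_def)
  then have "0 \<in> (\<lambda>v. grad (\<lambda>u. f u q) p + v) ` subdifferential (ind_fun X) p"
    by (rule rev_image_eqI) simp
  moreover have "grad (f p) q \<in> subdifferential (ind_fun Y) q"
    using assms(2) Y by (auto simp: subdifferential_def ind_fun_def zero_ereal_def)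
  then have "0 \<in> (\<lambda>v. - grad (f p) q + v) ` subdifferential (ind_fun Y) q"
    by (rule rev_image_eqI) simp
  ultimately show ?thesis using assms(1,2) by (simp add: game_stationary_def)
qed

text \<open>\<open>M\<close> is a real lower bound of the perturbed minimax value. Its condition
  speaks of upper bounds \<open>K\<close> of the inner function, which keeps suprema and extended
  reals out of the argument.\<close>

locale psgda_run = reg_minimax f X Y L rx
  for f :: "'a::euclidean_space \<Rightarrow> 'b::euclidean_space \<Rightarrow> real" and X Y L rx +
  fixes ry c \<alpha> \<beta> :: "nat \<Rightarrow> real" and x z :: "nat \<Rightarrow> 'a" and y :: "nat \<Rightarrow> 'b" and M :: real
  assumes steps: "psgda_steps L rx ry c \<alpha> \<beta>"
    and run: "psgda f X Y rx ry c \<alpha> \<beta> x y z"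
    and ry_dec: "decseq ry" and ry_lim: "ry \<longlonglongrightarrow> 0"
    and ry_slow: "filterlim (\<lambda>t. real t * ry t) at_top sequentially"
    and M: "u \<in> X \<Longrightarrow> (\<And>w. w \<in> Y \<Longrightarrow> f u w - ry 0 / 2 * (norm w)\<^sup>2 \<le> K) \<Longrightarrow> M \<le> K"
begin

lemma x_Suc: "x (Suc t) = closest_point X (x t - c t *\<^sub>R (gx (x t) (y t) + rx *\<^sub>R (x t - z t)))"
  and y_Suc: "y (Suc t) = closest_point Y (y t + \<alpha> t *\<^sub>R (gy (x (Suc t)) (y t) - ry t *\<^sub>R y t))"
  and z_Suc: "z (Suc t) = z t + \<beta> t *\<^sub>R (x (Suc t) - z t)"
  using run unfolding psgda_def grad_Freg_x grad_Freg_y by blast+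

lemma x_Suc_in: "x (Suc t) \<in> X"
  unfolding x_Suc by (rule closest_point_in_set[OF X(2,1)])

lemma y_Suc_in: "y (Suc t) \<in> Y"
  unfolding y_Suc by (rule closest_point_in_set[OF closed_Y Y(1)])

text \<open>The starting point is not assumed feasible; projection makes every later iterate
  feasible.\<close>

lemma x_in: "1 \<le> t \<Longrightarrow> x t \<in> X" and y_in: "1 \<le> t \<Longrightarrow> y t \<in> Y"
  using x_Suc_in[of "t - 1"] y_Suc_in[of "t - 1"] by simp_all

lemma ry_pos: "0 < ry t" and c_pos: "0 < c t" and \<alpha>_pos: "0 < \<alpha> t" and \<beta>_pos: "0 < \<beta> t"
  using steps unfolding psgda_steps_def by blast+

lemma c_le: "c t * (rx + L) \<le> 1"
proof -
  have "c t < 1 / (rx + L + ry t)" using steps unfolding psgda_steps_def by blast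
  then have "c t * (rx + L + ry t) \<le> 1"
    using ry_pos[of t] rx L_pos by (simp add: field_simps)
  moreover have "c t * (rx + L) \<le> c t * (rx + L + ry t)" using c_pos[of t] ry_pos[of t] by simp
  ultimately show ?thesis by linarith
qed

section \<open>Summability and decay of the residuals\<close>

abbreviation res :: "nat \<Rightarrow> real" where "res \<equiv> residual f X Y rx ry c \<alpha> \<beta> x y z"

abbreviation yp :: "nat \<Rightarrow> 'b" where "yp t \<equiv> yplus f X Y rx (ry t) (\<alpha> t) (y t) (z t)"

lemma res_descent:
  assumes t: "1 \<le> t" and r: "ry t < rx - L"
  shows "res t \<le> potential (ry t) (x t) (y t) (z t) - potential (ry t) (x (Suc t)) (y (Suc t)) (z (Suc t))"
  unfolding residual_def x_Suc y_Suc z_Suc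
proof (rule potential_descent)
  define m where "m = rx - L - ry t"
  have m: "0 < m" "m \<le> rx - L" using r ry_pos[of t] by (auto simp: m_def)
  have Lr: "0 < L + ry t" using ry_pos[of t] L_pos by simp
  have "\<alpha> t \<le> 1 / (11 * (L + ry t))"
    and a2: "\<alpha> t \<le> (c t)\<^sup>2 * m\<^sup>2 / (4 * (L + ry t) * (1 + c t * m)\<^sup>2)"
    using steps unfolding psgda_steps_def m_def by auto
  then show "11 * \<alpha> t * (L + ry t) \<le> 1" using Lr by (simp add: field_simps)
  show "4 * \<alpha> t * L \<le> (c t * (rx - L))\<^sup>2"
  proof -
    have cm: "1 \<le> (1 + c t * m)\<^sup>2" using m c_pos[of t] by simp
    have "4 * \<alpha> t * L \<le> 4 * \<alpha> t * (L + ry t) * 1"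
      using \<alpha>_pos[of t] ry_pos[of t] by simp
    also have "\<dots> \<le> 4 * \<alpha> t * (L + ry t) * (1 + c t * m)\<^sup>2"
      using \<alpha>_pos[of t] Lr cm by (intro mult_left_mono) auto
    also have "\<dots> \<le> (c t)\<^sup>2 * m\<^sup>2"
    proof -
      have "0 < 4 * (L + ry t) * (1 + c t * m)\<^sup>2" using Lr cm by (intro mult_pos_pos) auto
      then show ?thesis using a2 by (simp add: pos_le_divide_eq mult_ac)
    qed
    also have "\<dots> \<le> (c t)\<^sup>2 * (rx - L)\<^sup>2" using m by (intro mult_left_mono power_mono) auto
    finally show ?thesis by (simp add: power_mult_distrib)
  qed
  show "\<beta> t \<le> 1 / 36" using steps unfolding psgda_steps_def by auto
  show "384 * rx * \<alpha> t * \<beta> t * (omega L rx (ry t) (\<alpha> t))\<^sup>2 \<le> 1"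
  proof -
    define D where "D = 384 * rx * \<alpha> t * (omega L rx (ry t) (\<alpha> t))\<^sup>2"
    have D: "0 \<le> D" using rx L_pos \<alpha>_pos[of t] by (simp add: D_def)
    have "\<beta> t \<le> 1 / D" using steps unfolding psgda_steps_def D_def by blast
    \<comment> \<open>Division by zero yields 0, so \<open>D = 0\<close> is treated apart; there the
      product is 0.\<close>
    then have "\<beta> t * D \<le> 1" using D by (cases "D = 0") (auto simp: field_simps)
    then show ?thesis by (simp add: D_def mult_ac)
  qed
qed (use t r x_in y_in ry_pos c_pos c_le \<alpha>_pos \<beta>_pos in auto)

lemma res_nonneg: "0 \<le> res t"
  unfolding residual_def using c_pos[of t] \<alpha>_pos[of t] \<beta>_pos[of t] rx L_pos by simp

text \<open>Telescoping of \<open>\<psi>\<close>, whose extra term \<open>3 / 2 * B * ry t\<close>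
  pays exactly for the change of perturbation. The start \<open>t0\<close> ensures feasibility and
  \<open>ry t < rx - L\<close>.\<close>

lemma res_partial_sums_bounded:
  "\<exists>t0 C. 1 \<le> t0 \<and> 0 \<le> C \<and> (\<forall>n. sum res {t0..<n} \<le> C)"
proof -
  obtain B where B: "\<And>w. w \<in> Y \<Longrightarrow> (norm w)\<^sup>2 \<le> B"
  proof -
    have "bounded Y" using Y(2) compact_imp_bounded by blast
    then obtain b where "\<And>w. w \<in> Y \<Longrightarrow> norm w \<le> b" unfolding bounded_iff by blast
    then show ?thesis using that[of "b\<^sup>2"] by (meson norm_ge_zero power_mono)
  qed
  have B_nonneg: "0 \<le> B" using B Y(1) by (meson all_not_in_conv order_trans zero_le_power2)
  have "eventually (\<lambda>t. ry t < rx - L) sequentially"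
    using ry_lim rx L_pos by (intro order_tendstoD) auto
  then obtain t1 where t1: "\<And>t. t1 \<le> t \<Longrightarrow> ry t < rx - L"
    unfolding eventually_sequentially by blast
  define t0 where "t0 = max 1 t1"
  define \<psi> where "\<psi> t = potential (ry t) (x t) (y t) (z t) + 3 / 2 * B * ry t" for t
  have step: "res t \<le> \<psi> t - \<psi> (Suc t)" if "t0 \<le> t" for t
  proof -
    have "res t \<le> potential (ry t) (x t) (y t) (z t) - potential (ry t) (x (Suc t)) (y (Suc t)) (z (Suc t))"
      by (rule res_descent) (use that t1 in \<open>auto simp: t0_def\<close>)
    moreover have "potential (ry (Suc t)) (x (Suc t)) (y (Suc t)) (z (Suc t))
      \<le> potential (ry t) (x (Suc t)) (y (Suc t)) (z (Suc t)) + 3 / 2 * B * (ry t - ry (Suc t))"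
      by (rule potential_antimono_r[OF y_Suc_in _ B]) (use ry_dec in \<open>auto simp: decseq_SucD\<close>)
    ultimately show ?thesis unfolding \<psi>_def right_diff_distrib by linarith
  qed
  have low: "M \<le> \<psi> t" if "t0 \<le> t" for t
  proof -
    have "M \<le> potential (ry t) (x t) (y t) (z t)"
    proof (rule potential_lower[where ?r0.0 = "ry 0"])
      show "x t \<in> X" "y t \<in> Y" using that x_in y_in by (auto simp: t0_def)
      show "0 \<le> ry t" using ry_pos[of t] by simp
      show "ry t \<le> ry 0" using decseqD[OF ry_dec, of 0 t] by simp
    qed (rule M)
    moreover have "0 \<le> 3 / 2 * B * ry t" using B_nonneg ry_pos[of t] by simp
    ultimately show ?thesis unfolding \<psi>_def by linarith
  qed
  have "sum res {t0..<n} \<le> \<psi> t0 - M" for n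
  proof (cases "t0 \<le> n")
    case True
    then have "sum res {t0..<n} \<le> \<psi> t0 - \<psi> n"
    proof (induction n rule: dec_induct)
      case (step n)
      then show ?case using \<open>\<And>t. t0 \<le> t \<Longrightarrow> res t \<le> \<psi> t - \<psi> (Suc t)\<close>[of n] by simp
    qed simp
    then show ?thesis using low[OF True] by linarith
  next
    case False
    then show ?thesis using low[of t0] by simp
  qed
  moreover have "1 \<le> t0" by (simp add: t0_def)
  moreover have "0 \<le> \<psi> t0 - M" using low[of t0] by simp
  ultimately show ?thesis by blast
qed

text \<open>The minimal residual times the window length is at most the sum over the window. The
  window has at least \<open>t / 2\<close> elements and \<open>k \<le> t\<close>;
  \<open>2 * t0 \<le> k\<close> puts its left end at or after \<open>t0\<close>.\<close>

lemma res_Istar_le: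
  assumes C: "\<And>n. sum res {t0..<n} \<le> C"
    and k: "k \<in> Istar f X Y rx ry c \<alpha> \<beta> x y z \<infinity>" "2 * t0 \<le> k"
  shows "res k * real k \<le> 2 * C"
proof -
  obtain t where "is_arg_min res (\<lambda>k. k \<in> {t div 2..t}) k"
    using k(1) unfolding Istar_def by blast
  then have t: "k \<in> {t div 2..t}" "\<And>i. i \<in> {t div 2..t} \<Longrightarrow> res k \<le> res i"
    by (auto simp: is_arg_min_linorder)
  have "res k * real k \<le> 2 * (real (card {t div 2..t}) * res k)"
  proof -
    have "k \<le> 2 * card {t div 2..t}" using t(1) by auto
    then have "real k \<le> 2 * real (card {t div 2..t})" by linarith
    then have "res k * real k \<le> res k * (2 * real (card {t div 2..t}))"
      by (intro mult_left_mono res_nonneg)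
    then show ?thesis by (simp only: mult_ac)
  qed
  also have "\<dots> \<le> 2 * sum res {t div 2..t}"
    using sum_bounded_below[of "{t div 2..t}" "res k" res] t(2) by simp
  also have "\<dots> \<le> 2 * sum res {t0..<Suc t}"
    using t(1) k(2) by (intro mult_left_mono sum_mono2) (auto intro: res_nonneg)
  also have "\<dots> \<le> 2 * C" by (rule mult_left_mono[OF C]) simp
  finally show ?thesis .
qed

text \<open>Each residual term is \<open>O(1 / k)\<close> along \<open>\<sigma>\<close>, which
  forces \<open>x (Suc k)\<close>, \<open>z k\<close> and the inner minimiser to the limit
  \<open>p\<close>, and \<open>yp k\<close> to \<open>q\<close>. The projection inequalities then
  pass to the limit.\<close>

lemma limit_point_stationary:
  assumes \<sigma>: "strict_mono \<sigma>" "\<And>j. \<sigma> j \<in> Istar f X Y rx ry c \<alpha> \<beta> x y z \<infinity>"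
    and lim: "(\<lambda>j. x (\<sigma> j)) \<longlonglongrightarrow> p" "(\<lambda>j. y (\<sigma> j)) \<longlonglongrightarrow> q"
  shows "game_stationary f X Y 0 (p, q)"
proof -
  obtain t0 C where t0: "1 \<le> t0" and C: "\<And>n. sum res {t0..<n} \<le> C" "0 \<le> C"
    using res_partial_sums_bounded by blast
  obtain c0 c1 where c01: "0 < c0" "0 < c1" "\<And>t. c0 * (1 / L) \<le> c t" "\<And>t. c t \<le> c1 * (1 / L)"
    using steps unfolding psgda_steps_def theta_all_def by metis
  obtain a0 a1 where a01: "0 < a0" "0 < a1" "\<And>t. a0 * (1 / L) \<le> \<alpha> t" "\<And>t. \<alpha> t \<le> a1 * (1 / L)"
    using steps unfolding psgda_steps_def theta_all_def by metis
  obtain b0 where b0: "0 < b0" "\<And>t. b0 * (ry t / L) \<le> \<beta> t"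
    using steps unfolding psgda_steps_def theta_all_def by metis
  have rx_pos: "0 < rx" "0 < rx - L" using rx L_pos by auto
  have \<sigma>_top: "filterlim \<sigma> at_top sequentially" by (rule filterlim_subseq[OF \<sigma>(1)])
  have large: "eventually (\<lambda>j. 2 * t0 \<le> \<sigma> j) sequentially"
    using \<sigma>_top unfolding filterlim_at_top by blast
  have lim1: "(\<lambda>j. 1 / real (\<sigma> j)) \<longlonglongrightarrow> 0"
    by (rule tendsto_divide_0[OF tendsto_const filterlim_at_top_imp_at_infinity])
      (rule filterlim_compose[OF filterlim_real_sequentially \<sigma>_top])
  have lim2: "(\<lambda>j. 1 / (real (\<sigma> j) * ry (\<sigma> j))) \<longlonglongrightarrow> 0"
    by (rule tendsto_divide_0[OF tendsto_const filterlim_at_top_imp_at_infinity])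
      (rule filterlim_compose[OF ry_slow \<sigma>_top])
  have bound: "1 / (8 * c k) * (norm (x (Suc k) - x k))\<^sup>2 * real k \<le> 2 * C"
    "1 / (16 * \<alpha> k) * (norm (y k - yp k))\<^sup>2 * real k \<le> 2 * C"
    "rx * \<beta> k / 8 * (norm (z k - x (Suc k)))\<^sup>2 * real k \<le> 2 * C"
    if "k = \<sigma> j" "2 * t0 \<le> \<sigma> j" for j k
  proof -
    have R: "res k * real k \<le> 2 * C" using res_Istar_le[OF C(1) \<sigma>(2) that(2)] that(1) by simp
    have nn: "0 \<le> 1 / (8 * c k) * (norm (x (Suc k) - x k))\<^sup>2"
      "0 \<le> 1 / (16 * \<alpha> k) * (norm (y k - yp k))\<^sup>2" "0 \<le> rx * \<beta> k / 8 * (norm (z k - x (Suc k)))\<^sup>2"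
      using c_pos[of k] \<alpha>_pos[of k] \<beta>_pos[of k] rx_pos by simp_all
    then have "1 / (8 * c k) * (norm (x (Suc k) - x k))\<^sup>2 \<le> res k"
      "1 / (16 * \<alpha> k) * (norm (y k - yp k))\<^sup>2 \<le> res k"
      "rx * \<beta> k / 8 * (norm (z k - x (Suc k)))\<^sup>2 \<le> res k"
      unfolding residual_def by linarith+
    then show "1 / (8 * c k) * (norm (x (Suc k) - x k))\<^sup>2 * real k \<le> 2 * C"
      "1 / (16 * \<alpha> k) * (norm (y k - yp k))\<^sup>2 * real k \<le> 2 * C"
      "rx * \<beta> k / 8 * (norm (z k - x (Suc k)))\<^sup>2 * real k \<le> 2 * C"
      using R by (meson mult_right_mono of_nat_0_le_iff order_trans)+
  qed
  have dx: "(\<lambda>j. x (Suc (\<sigma> j)) - x (\<sigma> j)) \<longlonglongrightarrow> 0"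
  proof (rule tendsto_zero_if_sq_le[where K = "c1 * (1 / L) * (16 * C)", OF eventually_mono[OF large] lim1])
    fix j assume j: "2 * t0 \<le> \<sigma> j"
    define k where "k = \<sigma> j"
    have k: "0 < real k" using j t0 by (simp add: k_def)
    have "(norm (x (Suc k) - x k))\<^sup>2 * real k \<le> c k * (16 * C)"
      using bound(1)[OF k_def j] c_pos[of k] by (simp add: field_simps)
    also have "\<dots> \<le> c1 * (1 / L) * (16 * C)" using c01 C by (intro mult_right_mono) auto
    finally show "(norm (x (Suc (\<sigma> j)) - x (\<sigma> j)))\<^sup>2 \<le> c1 * (1 / L) * (16 * C) * (1 / real (\<sigma> j))"
      unfolding k_def[symmetric] using k by (rule le_mult_inverse_if)
  qed
  have dy: "(\<lambda>j. y (\<sigma> j) - yp (\<sigma> j)) \<longlonglongrightarrow> 0"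
  proof (rule tendsto_zero_if_sq_le[where K = "a1 * (1 / L) * (32 * C)", OF eventually_mono[OF large] lim1])
    fix j assume j: "2 * t0 \<le> \<sigma> j"
    define k where "k = \<sigma> j"
    have k: "0 < real k" using j t0 by (simp add: k_def)
    have "(norm (y k - yp k))\<^sup>2 * real k \<le> \<alpha> k * (32 * C)"
      using bound(2)[OF k_def j] \<alpha>_pos[of k] by (simp add: field_simps)
    also have "\<dots> \<le> a1 * (1 / L) * (32 * C)" using a01 C by (intro mult_right_mono) auto
    finally show "(norm (y (\<sigma> j) - yp (\<sigma> j)))\<^sup>2 \<le> a1 * (1 / L) * (32 * C) * (1 / real (\<sigma> j))"
      unfolding k_def[symmetric] using k by (rule le_mult_inverse_if)
  qed
  \<comment> \<open>Here the weight \<open>\<beta>\<close> vanishes in the limit. Since it is at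
    least a multiple of \<open>ry\<close>, the squared norm is \<open>O(1 / (k * ry k))\<close>, and
    the growth of \<open>t * ry t\<close> is what makes this tend to 0.\<close>
  have dz: "(\<lambda>j. z (\<sigma> j) - x (Suc (\<sigma> j))) \<longlonglongrightarrow> 0"
  proof (rule tendsto_zero_if_sq_le[where K = "16 * C * L / (rx * b0)", OF eventually_mono[OF large] lim2])
    fix j assume j: "2 * t0 \<le> \<sigma> j"
    define k where "k = \<sigma> j"
    define w where "w = (norm (z k - x (Suc k)))\<^sup>2"
    have k: "0 < real k" using j t0 by (simp add: k_def)
    have "rx * (b0 * (ry k / L)) / 8 * w * real k \<le> rx * \<beta> k / 8 * w * real k"
      using b0 rx_pos by (intro mult_right_mono divide_right_mono mult_left_mono) (auto simp: w_def)
    also have "\<dots> \<le> 2 * C" unfolding w_def by (rule bound(3)[OF k_def j])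
    finally have "w * (real k * ry k) \<le> 16 * C * L / (rx * b0)"
      using b0 rx_pos L_pos by (simp add: field_simps)
    then have "w \<le> 16 * C * L / (rx * b0) * (1 / (real k * ry k))"
      by (rule le_mult_inverse_if) (use k ry_pos[of k] in simp)
    then show "(norm (z (\<sigma> j) - x (Suc (\<sigma> j))))\<^sup>2 \<le> 16 * C * L / (rx * b0) * (1 / (real (\<sigma> j) * ry (\<sigma> j)))"
      by (simp add: k_def w_def)
  qed
  have x1: "(\<lambda>j. x (Suc (\<sigma> j))) \<longlonglongrightarrow> p" using tendsto_add[OF dx lim(1)] by simp
  have zl: "(\<lambda>j. z (\<sigma> j)) \<longlonglongrightarrow> p" using tendsto_add[OF dz x1] by simp
  have ypl: "(\<lambda>j. yp (\<sigma> j)) \<longlonglongrightarrow> q" using tendsto_diff[OF lim(2) dy] by simp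
  have pX: "p \<in> X" by (rule closed_sequentially[OF X(2) x_Suc_in x1])
  have qY: "q \<in> Y" by (rule closed_sequentially[OF closed_Y yplus_in ypl])
  \<comment> \<open>The gradient inside \<open>yp\<close> is taken at this minimiser and not at an
    iterate, so its convergence to \<open>p\<close> is needed; it follows from
    \<open>xstep_error\<close> and the lower bound on \<open>c\<close>.\<close>
  define um where "um j = xm (ry (\<sigma> j)) (y (\<sigma> j)) (z (\<sigma> j))" for j
  have "(\<lambda>j. x (Suc (\<sigma> j)) - um j) \<longlonglongrightarrow> 0"
  proof (rule tendsto_zero_if_norm_le[where K = "L / (c0 * (rx - L))", OF eventually_mono[OF large] dx])
    fix j assume j: "2 * t0 \<le> \<sigma> j"
    have "c0 * (1 / L) * (rx - L) * norm (x (Suc (\<sigma> j)) - um j)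
      \<le> c (\<sigma> j) * (rx - L) * norm (x (Suc (\<sigma> j)) - um j)"
      using c01 rx_pos by (intro mult_right_mono) auto
    also have "\<dots> \<le> norm (x (Suc (\<sigma> j)) - x (\<sigma> j))"
      unfolding um_def x_Suc
      by (rule xstep_error) (use j t0 x_in y_in c_pos c_le in auto)
    finally show "norm (x (Suc (\<sigma> j)) - um j)
      \<le> L / (c0 * (rx - L)) * norm (x (Suc (\<sigma> j)) - x (\<sigma> j))"
      using c01 rx_pos L_pos by (simp add: field_simps)
  qed
  from tendsto_diff[OF x1 this] have uml: "um \<longlonglongrightarrow> p" by simp
  have um_in: "um j \<in> X" if "2 * t0 \<le> \<sigma> j" for j
    unfolding um_def by (rule xm_in) (use that t0 y_in in auto)
  have gxl: "(\<lambda>j. gx (x (\<sigma> j)) (y (\<sigma> j))) \<longlonglongrightarrow> gx p q"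
  proof (rule LIM_zero_cancel, rule Lim_null_comparison)
    show "eventually (\<lambda>j. norm (gx (x (\<sigma> j)) (y (\<sigma> j)) - gx p q)
      \<le> L * (norm (x (\<sigma> j) - p) + norm (y (\<sigma> j) - q))) sequentially"
      using large by eventually_elim (rule gx_lip, use t0 pX qY x_in y_in in auto)
    show "(\<lambda>j. L * (norm (x (\<sigma> j) - p) + norm (y (\<sigma> j) - q))) \<longlonglongrightarrow> 0"
      using lim by (intro tendsto_mult_right_zero tendsto_add_zero tendsto_norm_zero LIM_zero)
  qed
  have gyl: "(\<lambda>j. gy (um j) (y (\<sigma> j))) \<longlonglongrightarrow> gy p q"
  proof (rule LIM_zero_cancel, rule Lim_null_comparison)
    show "eventually (\<lambda>j. norm (gy (um j) (y (\<sigma> j)) - gy p q)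
      \<le> L * (norm (um j - p) + norm (y (\<sigma> j) - q))) sequentially"
      using large by eventually_elim (rule gy_lip, use t0 pX qY um_in y_in in auto)
    show "(\<lambda>j. L * (norm (um j - p) + norm (y (\<sigma> j) - q))) \<longlonglongrightarrow> 0"
      using lim uml by (intro tendsto_mult_right_zero tendsto_add_zero tendsto_norm_zero LIM_zero)
  qed
  have cdx: "(\<lambda>j. (1 / c (\<sigma> j)) *\<^sub>R (x (Suc (\<sigma> j)) - x (\<sigma> j))) \<longlonglongrightarrow> 0"
  proof (rule tendsto_zero_if_norm_le[where K = "L / c0", OF always_eventually dx], rule allI)
    fix j
    have "1 / c (\<sigma> j) \<le> L / c0" using c01(3)[of "\<sigma> j"] c_pos[of "\<sigma> j"] c01(1) L_pos
      by (simp add: field_simps)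
    then show "norm ((1 / c (\<sigma> j)) *\<^sub>R (x (Suc (\<sigma> j)) - x (\<sigma> j)))
      \<le> L / c0 * norm (x (Suc (\<sigma> j)) - x (\<sigma> j))"
      using c_pos[of "\<sigma> j"] mult_right_mono[of "1 / c (\<sigma> j)" "L / c0"] by simp
  qed
  have ady: "(\<lambda>j. (1 / \<alpha> (\<sigma> j)) *\<^sub>R (y (\<sigma> j) - yp (\<sigma> j))) \<longlonglongrightarrow> 0"
  proof (rule tendsto_zero_if_norm_le[where K = "L / a0", OF always_eventually dy], rule allI)
    fix j
    have "1 / \<alpha> (\<sigma> j) \<le> L / a0" using a01(3)[of "\<sigma> j"] \<alpha>_pos[of "\<sigma> j"] a01(1) L_pos
      by (simp add: field_simps)
    then show "norm ((1 / \<alpha> (\<sigma> j)) *\<^sub>R (y (\<sigma> j) - yp (\<sigma> j)))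
      \<le> L / a0 * norm (y (\<sigma> j) - yp (\<sigma> j))"
      using \<alpha>_pos[of "\<sigma> j"] mult_right_mono[of "1 / \<alpha> (\<sigma> j)" "L / a0"] by simp
  qed
  show ?thesis
  proof (rule game_stationaryI[OF pX qY])
    fix u assume u: "u \<in> X"
    \<comment> \<open>The projection inequality divided by \<open>c\<close>. The quotient vanishes
      because \<open>1 / c\<close> is bounded, and the proximal term because \<open>x\<close> and
      \<open>z\<close> share the limit \<open>p\<close>.\<close>
    define h where "h j = (1 / c (\<sigma> j)) *\<^sub>R (x (Suc (\<sigma> j)) - x (\<sigma> j)) + gx (x (\<sigma> j)) (y (\<sigma> j))
      + rx *\<^sub>R (x (\<sigma> j) - z (\<sigma> j))" for j
    have h: "0 \<le> inner (h j) (u - x (Suc (\<sigma> j)))" for j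
    proof -
      define k where "k = \<sigma> j"
      define g where "g = gx (x k) (y k) + rx *\<^sub>R (x k - z k)"
      have "inner (x k - x (Suc k)) (u - x (Suc k)) \<le> - inner (- c k *\<^sub>R g) (u - x (Suc k))"
        using closest_point_inner[OF X(3,2) u, of "x k" "- c k *\<^sub>R g"] by (simp add: x_Suc g_def)
      then have "0 \<le> inner (x (Suc k) - x k) (u - x (Suc k)) + c k * inner g (u - x (Suc k))"
        by (simp add: inner_diff_left)
      also have "\<dots> = c k * inner ((1 / c k) *\<^sub>R (x (Suc k) - x k) + g) (u - x (Suc k))"
        using c_pos[of k] by (simp add: inner_add_left distrib_left)
      finally have "0 \<le> inner ((1 / c k) *\<^sub>R (x (Suc k) - x k) + g) (u - x (Suc k))"
        using c_pos[of k] by (simp add: zero_le_mult_iff)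
      then show ?thesis by (simp add: h_def g_def k_def add.assoc)
    qed
    have "h \<longlonglongrightarrow> 0 + gx p q + rx *\<^sub>R (p - p)"
      unfolding h_def by (intro tendsto_intros cdx gxl lim zl)
    then have lim_h: "(\<lambda>j. inner (h j) (u - x (Suc (\<sigma> j)))) \<longlonglongrightarrow> inner (0 + gx p q + rx *\<^sub>R (p - p)) (u - p)"
      by (intro tendsto_intros x1)
    show "0 \<le> inner (gx p q) (u - p)"
      using tendsto_lowerbound[OF lim_h always_eventually] h by simp
  next
    fix v assume v: "v \<in> Y"
    \<comment> \<open>The analogue for \<open>y\<close>, divided by \<open>\<alpha>\<close>; the
      perturbation term disappears because \<open>ry\<close> tends to 0 and \<open>y\<close>
      converges along \<open>\<sigma>\<close>.\<close>
    define h where "h j = (1 / \<alpha> (\<sigma> j)) *\<^sub>R (y (\<sigma> j) - yp (\<sigma> j))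
      + (gy (um j) (y (\<sigma> j)) - ry (\<sigma> j) *\<^sub>R y (\<sigma> j))" for j
    have h: "inner (h j) (v - yp (\<sigma> j)) \<le> 0" for j
    proof -
      define k where "k = \<sigma> j"
      define g where "g = gy (um j) (y k) - ry k *\<^sub>R y k"
      have "inner (y k - yp k) (v - yp k) \<le> - inner (\<alpha> k *\<^sub>R g) (v - yp k)"
        using closest_point_inner[OF Y(3) closed_Y v, of "y k" "\<alpha> k *\<^sub>R g"]
        unfolding yplus_eq g_def um_def k_def .
      then have "\<alpha> k * inner ((1 / \<alpha> k) *\<^sub>R (y k - yp k) + g) (v - yp k) \<le> 0"
        using \<alpha>_pos[of k] by (simp add: inner_add_left distrib_left)
      then have "inner ((1 / \<alpha> k) *\<^sub>R (y k - yp k) + g) (v - yp k) \<le> 0"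
        using \<alpha>_pos[of k] by (simp add: mult_le_0_iff)
      then show ?thesis by (simp add: h_def g_def k_def)
    qed
    have "h \<longlonglongrightarrow> 0 + (gy p q - 0 *\<^sub>R q)"
      unfolding h_def
      by (intro tendsto_intros ady gyl lim filterlim_compose[OF ry_lim \<sigma>_top])
    then have lim_h: "(\<lambda>j. inner (h j) (v - yp (\<sigma> j))) \<longlonglongrightarrow> inner (0 + (gy p q - 0 *\<^sub>R q)) (v - q)"
      by (intro tendsto_intros ypl)
    show "inner (gy p q) (v - q) \<le> 0"
      using tendsto_upperbound[OF lim_h always_eventually] h by simp
  qed
qed

end

theorem theorem3p6:
  fixes f :: "real ^ 'n \<Rightarrow> real ^ 'd \<Rightarrow> real"
    and X :: "(real ^ 'n) set" and Y :: "(real ^ 'd) set"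
    and L rx :: real
    and ry c \<alpha> \<beta> :: "nat \<Rightarrow> real"
    and x z :: "nat \<Rightarrow> real ^ 'n" and y :: "nat \<Rightarrow> real ^ 'd"
    and p :: "(real ^ 'n) \<times> (real ^ 'd)"
  assumes "X \<noteq> {}" "closed X" "convex X"
    and "Y \<noteq> {}" "compact Y" "convex Y" "0 \<in> Y" "diameter Y > 0"
    and "cont_diff (\<lambda>(u, v). f u v)"
    and "L > 0" "smooth_on L X Y f"
    and "\<And>u. u \<in> X \<Longrightarrow> concave_on Y (f u)"
    and "\<bar>INF u\<in>X. SUP v\<in>Y. ereal (f u v - ry 0 / 2 * (norm v)\<^sup>2)\<bar> \<noteq> \<infinity>"
    and "psgda_steps L rx ry c \<alpha> \<beta>"
    and "psgda f X Y rx ry c \<alpha> \<beta> x y z"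
    and "decseq ry" "ry \<longlonglongrightarrow> 0"
    and "filterlim (\<lambda>t. real t * ry t) at_top sequentially"
    and "limit_point_along (Istar f X Y rx ry c \<alpha> \<beta> x y z \<infinity>) (\<lambda>t. (x t, y t)) p"
  shows "game_stationary f X Y 0 p"
proof -
  \<comment> \<open>Finiteness of the minimax value makes the conversion to a real exact. Any real
    bound on the inner function at some \<open>u\<close> dominates the supremum there, hence the
    infimum \<open>M\<close>.\<close>
  define M where "M = real_of_ereal (INF u\<in>X. SUP v\<in>Y. ereal (f u v - ry 0 / 2 * (norm v)\<^sup>2))"
  have M: "ereal M = (INF u\<in>X. SUP v\<in>Y. ereal (f u v - ry 0 / 2 * (norm v)\<^sup>2))"
    unfolding M_def by (rule ereal_real'[OF assms(13)])
  interpret psgda_run f X Y L rx ry c \<alpha> \<beta> x z y M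
  proof
    show "(\<lambda>(u, v). f u v) differentiable (at p)" for p using assms(9) unfolding cont_diff_def by blast
    show "rx > 3 * L" using assms(14) by (simp add: psgda_steps_def)
    show "M \<le> K" if "u \<in> X" "\<And>w. w \<in> Y \<Longrightarrow> f u w - ry 0 / 2 * (norm w)\<^sup>2 \<le> K" for u K
    proof -
      have "ereal M \<le> (SUP v\<in>Y. ereal (f u v - ry 0 / 2 * (norm v)\<^sup>2))"
        unfolding M by (rule INF_lower[OF that(1)])
      also have "\<dots> \<le> ereal K" by (rule SUP_least) (use that(2) in simp)
      finally show ?thesis by simp
    qed
  qed (use assms in auto)
  obtain \<sigma> where \<sigma>: "strict_mono \<sigma>" "\<And>j. \<sigma> j \<in> Istar f X Y rx ry c \<alpha> \<beta> x y z \<infinity>"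
    "(\<lambda>j. (x (\<sigma> j), y (\<sigma> j))) \<longlonglongrightarrow> p"
    using assms(19) unfolding limit_point_along_def by blast
  from tendsto_fst[OF \<sigma>(3)] tendsto_snd[OF \<sigma>(3)]
  have "game_stationary f X Y 0 (fst p, snd p)" by (intro limit_point_stationary[OF \<sigma>(1,2)]) simp_all
  then show ?thesis by simp
qed

end
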